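(* Let $g\ge 2$ and let $G$ be the surface group with the symmetric presentation $G=\langle c_1,\dots,c_{2g}\mid c_1\cdots c_{2g}c_1^{-1}\cdots c_{2g}^{-1}\rangle$. Let $|\cdot|$ be the word length on $G$ with respect to $\{c_1,\dots,c_{2g}\}$. Then for every $x\in G$ with $x\neq 1$: (1) $|x^2|>|x|$; (2) $|x^k|=(k-1)(|x^2|-|x|)+|x|$ for all integers $k\ge 1$; (3) $\tau(x)=|x^2|-|x|$.
   Context: For $x\in G$, $|x|$ is the minimal number $n$ such that $x=x_1\cdots x_n$ with each $x_i\in\{c_1^{\pm1},\dots,c_{2g}^{\pm1}\}$. The stable word length (translation number) of $x$ is $\tau(x)=\lim_{n\to\infty}|x^n|/n$ (this limit always exists). *)

theory Defs
  imports Complex_Main "HOL-Algebra.Group"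
begin

text \<open>
  The letter \<open>(s, True)\<close> stands for the generator \<open>s\<close> and \<open>(s, False)\<close> for its formal inverse.
\<close>

type_synonym 's word = "('s \<times> bool) list"

definition words :: "'s set \<Rightarrow> 's word set" where
  "words S = lists (S \<times> UNIV)"

text \<open>
  Two words over \<open>S\<close> are related iff one is obtained from the other by finitely many insertions
  and deletions of trivial pairs \<open>s s\<^sup>-\<^sup>1\<close>, \<open>s\<^sup>-\<^sup>1 s\<close> and of relators from \<open>R\<close>, at any position.
\<close>

inductive_set pres_rel :: "'s set \<Rightarrow> 's word set \<Rightarrow> 's word rel" for S R where
  refl: "w \<in> words S \<Longrightarrow> (w, w) \<in> pres_rel S R"
| sym: "(v, w) \<in> pres_rel S R \<Longrightarrow> (w, v) \<in> pres_rel S R"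
| trans: "(u, v) \<in> pres_rel S R \<Longrightarrow> (v, w) \<in> pres_rel S R \<Longrightarrow> (u, w) \<in> pres_rel S R"
| cancel: "u \<in> words S \<Longrightarrow> v \<in> words S \<Longrightarrow> s \<in> S \<Longrightarrow>
    (u @ [(s, b), (s, \<not> b)] @ v, u @ v) \<in> pres_rel S R"
| relator: "u \<in> words S \<Longrightarrow> v \<in> words S \<Longrightarrow> r \<in> R \<Longrightarrow> r \<in> words S \<Longrightarrow>
    (u @ r @ v, u @ v) \<in> pres_rel S R"

definition presented_group :: "'s set \<Rightarrow> 's word set \<Rightarrow> 's word set monoid" where
  "presented_group S R =
    \<lparr>carrier = words S // pres_rel S R,
     monoid.mult = (\<lambda>A B. \<Union>a\<in>A. \<Union>b\<in>B. pres_rel S R `` {a @ b}),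
     one = pres_rel S R `` {[]}\<rparr>"

definition pres_gen :: "'s set \<Rightarrow> 's word set \<Rightarrow> 's \<Rightarrow> 's word set" where
  "pres_gen S R s = pres_rel S R `` {[(s, True)]}"

text \<open>
  The words witnessing the length are lists of group elements. The value is meaningful only for
  \<open>x\<close> in the subgroup generated by \<open>S\<close>.
\<close>

definition word_length :: "('a, 'b) monoid_scheme \<Rightarrow> 'a set \<Rightarrow> 'a \<Rightarrow> nat" where
  "word_length G S x =
    (LEAST n. \<exists>xs. length xs = n \<and> set xs \<subseteq> S \<union> m_inv G ` S \<and>
       x = foldr (\<lambda>a b. a \<otimes>\<^bsub>G\<^esub> b) xs \<one>\<^bsub>G\<^esub>)"

text \<open>
  For \<open>S\<close> generating a group \<open>G\<close> the limit exists by subadditivity of the word length, so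
  \<open>lim\<close> denotes it.
\<close>

definition stable_length :: "('a, 'b) monoid_scheme \<Rightarrow> 'a set \<Rightarrow> 'a \<Rightarrow> real" where
  "stable_length G S x = lim (\<lambda>n. real (word_length G S (x [^]\<^bsub>G\<^esub> n)) / real n)"

definition surface_relator :: "nat \<Rightarrow> nat word" where
  "surface_relator g =
    map (\<lambda>i. (i, True)) [1..<2 * g + 1] @ map (\<lambda>i. (i, False)) [1..<2 * g + 1]"

definition surface_group :: "nat \<Rightarrow> nat word set monoid" where
  "surface_group g = presented_group {1..2 * g} {surface_relator g}"

definition surface_gens :: "nat \<Rightarrow> nat word set set" where
  "surface_gens g = pres_gen {1..2 * g} {surface_relator g} ` {1..2 * g}"

abbreviation surface_length :: "nat \<Rightarrow> nat word set \<Rightarrow> nat" where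
  "surface_length g \<equiv> word_length (surface_group g) (surface_gens g)"

abbreviation surface_tau :: "nat \<Rightarrow> nat word set \<Rightarrow> real" where
  "surface_tau g \<equiv> stable_length (surface_group g) (surface_gens g)"


lemma words_append [simp]: "u @ v \<in> words S \<longleftrightarrow> u \<in> words S \<and> v \<in> words S"
  by (auto simp: words_def)

lemma words_Nil [simp]: "[] \<in> words S"
  by (simp add: words_def)

lemma words_Cons [simp]: "a # v \<in> words S \<longleftrightarrow> fst a \<in> S \<and> v \<in> words S"
  by (cases a) (auto simp: words_def)

lemma pres_rel_words: "(v, w) \<in> pres_rel S R \<Longrightarrow> v \<in> words S \<and> w \<in> words S"
  by (induction rule: pres_rel.induct) auto

lemma equiv_pres_rel: "equiv (words S) (pres_rel S R)"
proof (rule equivI)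
  show "pres_rel S R \<subseteq> words S \<times> words S"
    by (auto dest: pres_rel_words)
  show "refl_on (words S) (pres_rel S R)"
    by (rule refl_onI) (rule pres_rel.refl)
  show "sym (pres_rel S R)"
    by (rule symI) (rule pres_rel.sym)
  show "trans (pres_rel S R)"
    by (rule transI) (rule pres_rel.trans)
qed

lemma pres_rel_context:
  assumes "(v, w) \<in> pres_rel S R" "p \<in> words S" "q \<in> words S"
  shows "(p @ v @ q, p @ w @ q) \<in> pres_rel S R"
  using assms
proof (induction rule: pres_rel.induct)
  case (cancel u v s b)
  then show ?case using pres_rel.cancel[of "p @ u" S "v @ q" s b R] by simp
next
  case (relator u v r)
  then show ?case using pres_rel.relator[of "p @ u" S "v @ q" r R] by simp
next
  case (trans u v w)
  then show ?case by (blast intro: pres_rel.trans)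
qed (simp_all add: pres_rel.refl pres_rel.sym)

lemma pres_rel_append:
  assumes "(u, u') \<in> pres_rel S R" "(v, v') \<in> pres_rel S R"
  shows "(u @ v, u' @ v') \<in> pres_rel S R"
proof (rule pres_rel.trans)
  show "(u @ v, u' @ v) \<in> pres_rel S R"
    using pres_rel_context[OF assms(1), of "[]" v] pres_rel_words[OF assms(2)] by simp
  show "(u' @ v, u' @ v') \<in> pres_rel S R"
    using pres_rel_context[OF assms(2), of u' "[]"] pres_rel_words[OF assms(1)] by simp
qed

lemma presented_mult:
  assumes "u \<in> words S" "v \<in> words S"
  shows "(pres_rel S R `` {u}) \<otimes>\<^bsub>presented_group S R\<^esub> (pres_rel S R `` {v})
    = pres_rel S R `` {u @ v}"
proof -
  have "pres_rel S R `` {a @ b} = pres_rel S R `` {u @ v}"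
    if "a \<in> pres_rel S R `` {u}" "b \<in> pres_rel S R `` {v}" for a b
    using that by (intro equiv_class_eq[OF equiv_pres_rel, symmetric] pres_rel_append) simp_all
  moreover have "u \<in> pres_rel S R `` {u}" "v \<in> pres_rel S R `` {v}"
    using assms by (auto intro: pres_rel.refl)
  ultimately have "(\<Union>a\<in>pres_rel S R `` {u}. \<Union>b\<in>pres_rel S R `` {v}. pres_rel S R `` {a @ b})
      = pres_rel S R `` {u @ v}"
    by blast
  then show ?thesis
    by (simp add: presented_group_def)
qed

lemma presented_one: "\<one>\<^bsub>presented_group S R\<^esub> = pres_rel S R `` {[]}"
  by (simp add: presented_group_def)

lemma presented_carrier: "carrier (presented_group S R) = words S // pres_rel S R"
  by (simp add: presented_group_def)

lemma presented_class_closed [simp]: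
  "w \<in> words S \<Longrightarrow> pres_rel S R `` {w} \<in> carrier (presented_group S R)"
  by (simp add: presented_carrier quotientI)

lemma presented_carrierE:
  assumes "x \<in> carrier (presented_group S R)"
  obtains w where "w \<in> words S" "x = pres_rel S R `` {w}"
  using assms by (auto simp: presented_carrier elim: quotientE)

definition inv_word :: "'s word \<Rightarrow> 's word" where
  "inv_word w = rev (map (\<lambda>(s, b). (s, \<not> b)) w)"

lemma inv_word_words [simp]: "inv_word w \<in> words S \<longleftrightarrow> w \<in> words S"
  by (induction w) (auto simp: inv_word_def)

lemma pres_rel_inv_word:
  "w \<in> words S \<Longrightarrow> (inv_word w @ w, []) \<in> pres_rel S R"
proof (induction w)
  case Nil
  then show ?case by (auto simp: inv_word_def intro: pres_rel.refl)
next
  case (Cons a w)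
  obtain s b where a: "a = (s, b)" by (cases a)
  have "(inv_word w @ [(s, \<not> b), (s, \<not> \<not> b)] @ w, inv_word w @ w) \<in> pres_rel S R"
    using Cons.prems a by (intro pres_rel.cancel) auto
  then show ?case
    using pres_rel.trans[OF _ Cons.IH] Cons.prems a by (simp add: inv_word_def)
qed

lemma group_presented_group: "group (presented_group S R)"
proof (rule groupI)
  let ?G = "presented_group S R" and ?c = "\<lambda>w. pres_rel S R `` {w}"
  show "\<one>\<^bsub>?G\<^esub> \<in> carrier ?G"
    by (simp add: presented_one)
  show "x \<otimes>\<^bsub>?G\<^esub> y \<in> carrier ?G" if "x \<in> carrier ?G" "y \<in> carrier ?G" for x y
    using that by (elim presented_carrierE) (simp add: presented_mult)
  show "x \<otimes>\<^bsub>?G\<^esub> y \<otimes>\<^bsub>?G\<^esub> z = x \<otimes>\<^bsub>?G\<^esub> (y \<otimes>\<^bsub>?G\<^esub> z)"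
    if "x \<in> carrier ?G" "y \<in> carrier ?G" "z \<in> carrier ?G" for x y z
    using that by (elim presented_carrierE) (simp add: presented_mult)
  show "\<one>\<^bsub>?G\<^esub> \<otimes>\<^bsub>?G\<^esub> x = x" if "x \<in> carrier ?G" for x
    using that by (elim presented_carrierE) (simp add: presented_mult presented_one)
  show "\<exists>y\<in>carrier ?G. y \<otimes>\<^bsub>?G\<^esub> x = \<one>\<^bsub>?G\<^esub>" if x: "x \<in> carrier ?G" for x
  proof -
    obtain w where w: "w \<in> words S" "x = ?c w"
      using x by (rule presented_carrierE)
    have "?c (inv_word w) \<otimes>\<^bsub>?G\<^esub> x = \<one>\<^bsub>?G\<^esub>"
      using w equiv_class_eq[OF equiv_pres_rel pres_rel_inv_word[of w S R]]
      by (simp add: presented_mult presented_one)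
    moreover have "?c (inv_word w) \<in> carrier ?G"
      using w by simp
    ultimately show ?thesis by blast
  qed
qed

lemma group_surface_group: "group (surface_group g)"
  by (simp add: surface_group_def group_presented_group)

lemma presented_inv_gen:
  assumes "s \<in> S"
  shows "inv\<^bsub>presented_group S R\<^esub> (pres_gen S R s) = pres_rel S R `` {[(s, False)]}"
proof -
  interpret group "presented_group S R" by (rule group_presented_group)
  have "([(s, False), (s, True)], []) \<in> pres_rel S R"
    using pres_rel_inv_word[of "[(s, True)]" S R] assms by (simp add: inv_word_def)
  then have "pres_rel S R `` {[(s, False), (s, True)]} = pres_rel S R `` {[]}"
    by (rule equiv_class_eq[OF equiv_pres_rel])
  then have "pres_rel S R `` {[(s, False)]} \<otimes>\<^bsub>presented_group S R\<^esub> pres_gen S R s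
      = \<one>\<^bsub>presented_group S R\<^esub>"
    using assms by (simp add: pres_gen_def presented_mult presented_one)
  then show ?thesis
    using assms
    by (intro inv_equality) (simp_all add: pres_gen_def)
qed

lemma presented_group_generated:
  assumes "x \<in> carrier (presented_group S R)"
  shows "\<exists>xs. set xs \<subseteq> pres_gen S R ` S \<union> m_inv (presented_group S R) ` pres_gen S R ` S \<and>
    x = foldr (\<lambda>a b. a \<otimes>\<^bsub>presented_group S R\<^esub> b) xs \<one>\<^bsub>presented_group S R\<^esub>"
proof -
  let ?G = "presented_group S R" and ?c = "\<lambda>w. pres_rel S R `` {w}"
  let ?L = "pres_gen S R ` S \<union> m_inv ?G ` pres_gen S R ` S"
  have "\<exists>xs. set xs \<subseteq> ?L \<and> ?c w = foldr (\<lambda>a b. a \<otimes>\<^bsub>?G\<^esub> b) xs \<one>\<^bsub>?G\<^esub>" if "w \<in> words S" for w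
    using that
  proof (induction w)
    case Nil
    then show ?case by (intro exI[of _ "[]"]) (simp add: presented_one)
  next
    case (Cons a w)
    then obtain xs where xs: "set xs \<subseteq> ?L" "?c w = foldr (\<lambda>a b. a \<otimes>\<^bsub>?G\<^esub> b) xs \<one>\<^bsub>?G\<^esub>"
      by auto
    obtain s b where a: "a = (s, b)" by (cases a)
    have "?c [a] \<in> ?L"
      using Cons.prems a presented_inv_gen[of s S R]
      by (cases b) (auto simp: pres_gen_def image_iff intro!: bexI[of _ s])
    moreover have "?c (a # w) = ?c [a] \<otimes>\<^bsub>?G\<^esub> ?c w"
      using Cons.prems by (simp add: presented_mult)
    ultimately show ?case
      using xs by (intro exI[of _ "?c [a] # xs"]) simp
  qed
  then show ?thesis
    using assms by (elim presented_carrierE) blast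
qed

end

theory Submission imports Defs begin

text \<open>
  The relator contains each generator \<open>t = c\<^sub>i\<close> exactly once with either sign, so it can be read as
  \<open>t a t\<^sup>-\<^sup>1 = rev a\<close> with \<open>a = c\<^sub>i\<^sub>+\<^sub>1 \<cdots> c\<^sub>2\<^sub>g c\<^sub>1\<^sup>-\<^sup>1 \<cdots> c\<^sub>i\<^sub>-\<^sub>1\<^sup>-\<^sup>1\<close>. Hence \<open>G\<close> is an HNN extension, with stable letter \<open>t\<close>,
  of the free group on the other generators. Both associated words have the same length, so
  replacing a pinch \<open>t f t\<^sup>-\<^sup>1\<close>, \<open>f\<close> a power of \<open>a\<close>, by \<open>rev f\<close> shortens a word by two. A shortest word
  therefore has no pinches for any \<open>t\<close>, and by Britton's lemma it contains the least possible number
  of letters \<open>t\<^sup>\<plusminus>\<^sup>1\<close> for all \<open>t\<close> simultaneously: \<open>|x|\<close> is the sum over \<open>t\<close> of the HNN lengths of \<open>x\<close>.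

  Each HNN length is affine on the powers \<open>x\<^sup>k\<close>, \<open>k \<ge> 1\<close>. Write \<open>x = P y P\<^sup>-\<^sup>1\<close> with \<open>y\<close> cyclically
  pinch-free; then \<open>P y\<^sup>k P\<^sup>-\<^sup>1\<close> has no pinches. When \<open>y\<close> does not involve \<open>t\<close> this uses that \<open>\<langle>a\<rangle>\<close>
  and \<open>\<langle>rev a\<rangle>\<close> are closed under roots in the free group.

  So \<open>|x\<^sup>k| = D + k \<tau>\<close>. If \<open>\<tau> = 0\<close>, the powers of \<open>x\<close> lie in a finite set, some \<open>x\<^sup>m\<close> with \<open>m \<ge> 1\<close> is
  trivial, so \<open>D = 0\<close> and \<open>x = 1\<close>.
\<close>

section \<open>Formal inverses and powers of words\<close>

definition letter_inv :: "'s \<times> bool \<Rightarrow> 's \<times> bool" where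
  "letter_inv x = (fst x, \<not> snd x)"

lemma letter_inv_simps [simp]:
  "letter_inv (letter_inv x) = x" "fst (letter_inv x) = fst x" "letter_inv x \<noteq> x" "x \<noteq> letter_inv x"
  by (auto simp: letter_inv_def prod_eq_iff)

lemma inv_word_Nil [simp]: "inv_word [] = []"
  and inv_word_Cons [simp]: "inv_word (x # w) = inv_word w @ [letter_inv x]"
  and inv_word_append [simp]: "inv_word (v @ w) = inv_word w @ inv_word v"
  and rev_inv_word: "rev (inv_word w) = inv_word (rev w)"
  by (auto simp: inv_word_def letter_inv_def split: prod.splits simp flip: rev_map)

lemma inv_word_inv_word [simp]: "inv_word (inv_word w) = w"
  by (induction w) auto

lemma map_fst_inv_word: "map fst (inv_word w) = rev (map fst w)"
  by (induction w) auto

lemma words_rev [simp]: "rev w \<in> words S \<longleftrightarrow> w \<in> words S"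
  by (simp add: words_def lists_eq_set)

definition wpow :: "'a list \<Rightarrow> nat \<Rightarrow> 'a list" where
  "wpow w k = concat (replicate k w)"

lemma wpow_0 [simp]: "wpow w 0 = []"
  and wpow_Suc [simp]: "wpow w (Suc k) = w @ wpow w k"
  by (simp_all add: wpow_def)

lemma wpow_add: "wpow w (j + k) = wpow w j @ wpow w k"
  by (induction j) auto

lemma wpow_Suc2: "wpow w (Suc k) = wpow w k @ w"
  using wpow_add[of w k 1] by simp

lemma rev_wpow: "rev (wpow w k) = wpow (rev w) k"
  by (induction k) (simp_all flip: wpow_Suc2)

lemma inv_word_wpow: "inv_word (wpow w k) = wpow (inv_word w) k"
  by (induction k) (simp_all flip: wpow_Suc2)

lemma words_wpow: "w \<in> words S \<Longrightarrow> wpow w k \<in> words S"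
  by (induction k) auto

lemma length_wpow [simp]: "length (wpow w k) = k * length w"
  by (induction k) auto

lemma set_wpow: "set (wpow w k) \<subseteq> set w"
  by (induction k) auto

lemma nth_wpow: "i < k * length w \<Longrightarrow> wpow w k ! i = w ! (i mod length w)"
proof (induction k arbitrary: i)
  case (Suc k)
  then show ?case
    by (cases "i < length w") (auto simp: nth_append mod_if[of i])
qed simp

lemma hd_wpow: "k \<ge> 1 \<Longrightarrow> w \<noteq> [] \<Longrightarrow> hd (wpow w k) = hd w"
  by (cases k) auto

lemma last_wpow: "k \<ge> 1 \<Longrightarrow> w \<noteq> [] \<Longrightarrow> last (wpow w k) = last w"
  by (cases k) (auto simp: wpow_Suc2 simp del: wpow_Suc)

lemma wpow_eq_Nil_iff [simp]: "wpow w k = [] \<longleftrightarrow> k = 0 \<or> w = []"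
  by (auto simp flip: length_0_conv)

section \<open>Calculating modulo a presentation\<close>

lemma pres_rel_mono:
  assumes "(v, w) \<in> pres_rel S R" "S \<subseteq> S'" "R \<subseteq> R'"
  shows "(v, w) \<in> pres_rel S' R'"
proof -
  have words: "u \<in> words S \<Longrightarrow> u \<in> words S'" for u :: "'a word"
    using assms(2) by (auto simp: words_def lists_eq_set)
  show ?thesis
    using assms
  proof (induction rule: pres_rel.induct)
    case (trans u v w)
    then show ?case by (blast intro: pres_rel.trans)
  next
    case (cancel u v s b)
    then show ?case by (intro pres_rel.cancel words) auto
  next
    case (relator u v r)
    then show ?case by (intro pres_rel.relator words) auto
  qed (auto intro: pres_rel.refl words pres_rel.sym)
qed

lemma pres_rel_inv_word_right:
  assumes "w \<in> words S" shows "(w @ inv_word w, []) \<in> pres_rel S R"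
  using pres_rel_inv_word[of "inv_word w" S R] assms by simp

lemma pres_rel_cancel_left:
  assumes "(p @ v, w) \<in> pres_rel S R" shows "(v, inv_word p @ w) \<in> pres_rel S R"
proof -
  have pv: "p \<in> words S" "v \<in> words S"
    using pres_rel_words[OF assms] by auto
  have "(inv_word p @ p @ v, inv_word p @ w) \<in> pres_rel S R"
    using pv assms by (intro pres_rel_append pres_rel.refl) auto
  moreover have "((inv_word p @ p) @ v, [] @ v) \<in> pres_rel S R"
    using pv by (intro pres_rel_append pres_rel_inv_word pres_rel.refl) auto
  ultimately show ?thesis
    by (metis append_Nil append_assoc pres_rel.sym pres_rel.trans)
qed

lemma pres_rel_cancel_right:
  assumes "(v @ p, w) \<in> pres_rel S R" shows "(v, w @ inv_word p) \<in> pres_rel S R"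
proof -
  have pv: "p \<in> words S" "v \<in> words S"
    using pres_rel_words[OF assms] by auto
  have "((v @ p) @ inv_word p, w @ inv_word p) \<in> pres_rel S R"
    using pv assms by (intro pres_rel_append pres_rel.refl) auto
  moreover have "(v @ (p @ inv_word p), v @ []) \<in> pres_rel S R"
    using pv by (intro pres_rel_append pres_rel_inv_word_right pres_rel.refl) auto
  ultimately show ?thesis
    by (metis append_Nil2 append_assoc pres_rel.sym pres_rel.trans)
qed

lemma pres_rel_wpow:
  assumes "(v, w) \<in> pres_rel S R" shows "(wpow v k, wpow w k) \<in> pres_rel S R"
  by (induction k) (auto intro: pres_rel_append assms pres_rel.refl)

text \<open>Reversing a trivial pair gives a trivial pair, so without relators reversal descends to
  the free group, as an anti-automorphism.\<close>

lemma pres_rel_rev: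
  assumes "(v, w) \<in> pres_rel S {}" shows "(rev v, rev w) \<in> pres_rel S {}"
  using assms
proof (induction rule: pres_rel.induct)
  case (cancel u v s b)
  then show ?case
    using pres_rel.cancel[of "rev v" S "rev u" s "\<not> b"] by simp
next
  case (trans u v w)
  then show ?case by (blast intro: pres_rel.trans)
qed (auto intro: pres_rel.refl pres_rel.sym)

lemma pres_rel_conj_wpow:
  assumes "p \<in> words S" "y \<in> words S" "k \<ge> 1"
  shows "(wpow (p @ y @ inv_word p) k, p @ wpow y k @ inv_word p) \<in> pres_rel S R"
  using \<open>k \<ge> 1\<close>
proof (induction k rule: dec_induct)
  case base
  then show ?case using assms by (auto intro: pres_rel.refl)
next
  case (step k)
  have "((p @ y @ inv_word p) @ wpow (p @ y @ inv_word p) k,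
      (p @ y @ inv_word p) @ (p @ wpow y k @ inv_word p)) \<in> pres_rel S R"
    by (intro pres_rel_append step.IH pres_rel.refl) (use assms in auto)
  moreover have "((p @ y) @ (inv_word p @ p) @ (wpow y k @ inv_word p),
      (p @ y) @ [] @ (wpow y k @ inv_word p)) \<in> pres_rel S R"
    by (intro pres_rel_context pres_rel_inv_word) (use assms in \<open>auto intro: words_wpow\<close>)
  ultimately show ?case
    by (auto intro: pres_rel.trans)
qed

lemma presented_nat_pow:
  assumes "w \<in> words S"
  shows "pres_rel S R `` {w} [^]\<^bsub>presented_group S R\<^esub> (n :: nat) = pres_rel S R `` {wpow w n}"
proof (induction n)
  case 0
  then show ?case
    by (simp add: monoid.nat_pow_0[OF group.is_monoid[OF group_presented_group]] presented_one)
next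
  case (Suc n)
  then show ?case
    using assms presented_mult[of "wpow w n" S w R] wpow_Suc2[of w n]
    by (simp add: words_wpow monoid.nat_pow_Suc[OF group.is_monoid[OF group_presented_group]])
qed

section \<open>Roots in free groups\<close>

definition freely_reduced :: "'s word \<Rightarrow> bool" where
  "freely_reduced w = successively (\<lambda>x y. y \<noteq> letter_inv x) w"

text \<open>Left multiplication by a letter on reduced words. As in van der Waerden's argument, a
  letter and its inverse act as inverse bijections, so freely equivalent words act alike; a reduced
  word is recovered from its action on the empty word, hence reduced forms are unique.\<close>

definition push :: "'s \<times> bool \<Rightarrow> 's word \<Rightarrow> 's word" where
  "push x w = (if w \<noteq> [] \<and> hd w = letter_inv x then tl w else x # w)"

lemma freely_reduced_Nil [simp]: "freely_reduced []"
  by (simp add: freely_reduced_def)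

lemma freely_reduced_append:
  "freely_reduced (v @ w) \<longleftrightarrow> freely_reduced v \<and> freely_reduced w \<and>
    (v \<noteq> [] \<longrightarrow> w \<noteq> [] \<longrightarrow> hd w \<noteq> letter_inv (last v))"
  by (auto simp: freely_reduced_def successively_append_iff)

lemma freely_reduced_Cons:
  "freely_reduced (x # w) \<longleftrightarrow> freely_reduced w \<and> (w \<noteq> [] \<longrightarrow> hd w \<noteq> letter_inv x)"
  by (cases w) (auto simp: freely_reduced_def)

lemma freely_reduced_push: "freely_reduced w \<Longrightarrow> freely_reduced (push x w)"
  by (cases w) (auto simp: push_def freely_reduced_Cons)

lemma freely_reduced_foldr_push: "freely_reduced z \<Longrightarrow> freely_reduced (foldr push w z)"
  by (induction w) (auto intro: freely_reduced_push)

lemma push_push_inv: "freely_reduced w \<Longrightarrow> push x (push (letter_inv x) w) = w"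
  by (cases w) (auto simp: push_def freely_reduced_Cons neq_Nil_conv)

lemma foldr_push_pres_rel:
  assumes "(v, w) \<in> pres_rel S {}" "freely_reduced z"
  shows "foldr push v z = foldr push w z"
  using assms
proof (induction arbitrary: z rule: pres_rel.induct)
  case (cancel u v s b)
  then have "push (s, b) (push (s, \<not> b) (foldr push v z)) = foldr push v z"
    using push_push_inv[of "foldr push v z" "(s, b)"]
    by (simp add: letter_inv_def freely_reduced_foldr_push)
  then show ?case by simp
qed auto

lemma foldr_push_reduced: "freely_reduced w \<Longrightarrow> foldr push w [] = w"
  by (induction w) (auto simp: push_def freely_reduced_Cons)

lemma freely_reduced_unique:
  "(v, w) \<in> pres_rel S {} \<Longrightarrow> freely_reduced v \<Longrightarrow> freely_reduced w \<Longrightarrow> v = w"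
  using foldr_push_pres_rel[of v w S "[]"] by (simp add: foldr_push_reduced)

lemma foldr_push_equiv:
  "w \<in> words S \<Longrightarrow> (w, foldr push w []) \<in> pres_rel S R"
proof (induction w)
  case Nil
  then show ?case by (auto intro: pres_rel.refl)
next
  case (Cons x w)
  let ?z = "foldr push w []"
  have *: "([x] @ w, [x] @ ?z) \<in> pres_rel S R"
    by (intro pres_rel_append pres_rel.refl Cons.IH) (use Cons.prems in auto)
  show ?case
  proof (cases "?z \<noteq> [] \<and> hd ?z = letter_inv x")
    case True
    then have z: "[x] @ ?z = [] @ [(fst x, snd x), (fst x, \<not> snd x)] @ tl ?z"
      by (cases ?z) (auto simp: letter_inv_def)
    have "?z \<in> words S"
      using Cons pres_rel_words by auto
    then have "tl ?z \<in> words S"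
      by (cases ?z) auto
    then have "([x] @ ?z, [] @ tl ?z) \<in> pres_rel S R"
      unfolding z using Cons.prems by (intro pres_rel.cancel) auto
    then show ?thesis
      using * True pres_rel.trans[OF *] by (simp add: push_def[of x])
  next
    case False
    then have "push x ?z = x # ?z" by (auto simp: push_def)
    then show ?thesis using * by simp
  qed
qed

text \<open>Mutually inverse end letters are stripped off until none remain; reducedness of
  \<open>y @ y\<close> expresses that \<open>y\<close> is cyclically reduced.\<close>

lemma freely_reduced_conjugate:
  "freely_reduced w \<Longrightarrow> \<exists>p y. w = p @ y @ inv_word p \<and> freely_reduced (y @ y)"
proof (induction "length w" arbitrary: w rule: less_induct)
  case less
  show ?case
  proof (cases "freely_reduced (w @ w)")
    case True
    then show ?thesis by (intro exI[of _ "[]"] exI[of _ w]) simp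
  next
    case False
    then have w: "w \<noteq> []" "hd w = letter_inv (last w)"
      using less.prems by (auto simp: freely_reduced_append)
    define x where "x = hd w"
    from w obtain v where "w = x # v" by (cases w) (auto simp: x_def)
    moreover from this w have "v \<noteq> []" "last v = letter_inv x" by (auto split: if_splits)
    ultimately obtain u where u: "w = x # u @ [letter_inv x]"
      by (metis append_butlast_last_id)
    have "freely_reduced u"
      using less.prems u by (auto simp: freely_reduced_Cons freely_reduced_append)
    then obtain p y where "u = p @ y @ inv_word p" "freely_reduced (y @ y)"
      using less.hyps[of u] u by auto
    then show ?thesis
      using u by (intro exI[of _ "x # p"] exI[of _ y]) simp
  qed
qed

lemma freely_reduced_wpow:
  "freely_reduced (y @ y) \<Longrightarrow> freely_reduced (wpow y k)"
proof (induction k)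
  case (Suc k)
  then show ?case
    by (cases "k = 0 \<or> y = []") (auto simp: freely_reduced_append hd_wpow)
qed simp

text \<open>Two letters of \<open>a\<close> on the same generator are the same letter, and no letter
  is its own inverse; so nothing cancels, not even at the seam.\<close>

lemma freely_reduced_distinct:
  assumes "distinct (map fst a)" shows "freely_reduced (a @ a)"
proof -
  have "freely_reduced a"
    using assms
  proof (induction a)
    case (Cons x a)
    then show ?case by (cases a) (auto simp: freely_reduced_Cons letter_inv_def)
  qed simp
  moreover have "hd a \<noteq> letter_inv (last a)" if "a \<noteq> []"
  proof
    assume "hd a = letter_inv (last a)"
    then have "fst (hd a) = fst (last a)" by simp
    with assms that have "hd a = last a"
      by (metis distinct_map hd_in_set inj_onD last_in_set)
    with \<open>hd a = letter_inv (last a)\<close> show False by simp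
  qed
  ultimately show ?thesis by (auto simp: freely_reduced_append)
qed

lemma wpow_eq_wpow_distinct:
  assumes "wpow y k = wpow a m" "k \<ge> 1" "distinct a"
  shows "\<exists>l. y = wpow a l"
proof (cases "k = 1 \<or> y = []")
  case True
  then show ?thesis
    using assms by (auto intro: exI[of _ 0] exI[of _ m])
next
  case False
  then have k: "k \<ge> 2" and y: "y \<noteq> []" using assms(2) by auto
  have len: "k * length y = m * length a"
    using arg_cong[OF assms(1), of length] by simp
  have "k * length y \<ge> 2 * length y"
    using k by simp
  then have lt: "length y < k * length y"
    using y by (cases y) auto
  then have a: "a \<noteq> []"
    using len by auto
  have eq: "y ! (i mod length y) = a ! (i mod length a)" if "i < k * length y" for i
    using that nth_wpow[of i k y] nth_wpow[of i m a] len assms(1) by simp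
  \<comment> \<open>The second copy of \<open>y\<close> starts at position \<open>length y\<close>,
    which therefore carries the first letter of \<open>a\<close>; as the letters of \<open>a\<close>
    are distinct, a copy of \<open>a\<close> starts there too.\<close>
  have "a ! (length y mod length a) = a ! 0"
    using eq[of "length y"] eq[of 0] lt by simp
  then have "length y mod length a = 0"
    using a assms(3) by (subst (asm) nth_eq_iff_index_eq) auto
  then obtain l where l: "length y = l * length a"
    by (metis dvd_eq_mod_eq_0 dvdE mult.commute)
  have "y ! i = wpow a l ! i" if "i < length y" for i
  proof -
    have "y ! i = a ! (i mod length a)"
      using eq[of i] that lt by simp
    then show ?thesis using that l by (simp add: nth_wpow)
  qed
  then have "y = wpow a l"
    using l by (intro nth_equalityI) auto
  then show ?thesis ..
qed

text \<open>With the reduced form of \<open>w\<close> written as a conjugate of a cyclically reduced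
  core, its power has an evident reduced form, which must coincide letter by letter with
  \<open>wpow a m\<close>.\<close>

lemma free_root:
  assumes "w \<in> words S" "k \<ge> 1" "distinct (map fst a)"
    and "(wpow w k, wpow a m) \<in> pres_rel S {}"
  shows "\<exists>l. (w, wpow a l) \<in> pres_rel S {}"
proof -
  define v where "v = foldr push w []"
  have wv: "(w, v) \<in> pres_rel S {}" and red_v: "freely_reduced v"
    using foldr_push_equiv[OF assms(1)] by (auto simp: v_def intro: freely_reduced_foldr_push)
  obtain p y where v: "v = p @ y @ inv_word p" and yy: "freely_reduced (y @ y)"
    using freely_reduced_conjugate[OF red_v] by blast
  have vS: "v \<in> words S" using wv pres_rel_words by blast
  then have py: "p \<in> words S" "y \<in> words S" by (auto simp: v)
  show ?thesis
  proof (cases "y = []")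
    case True
    then have "(w, []) \<in> pres_rel S {}"
      using wv pres_rel_inv_word_right[OF py(1), of "{}"] v by (auto intro: pres_rel.trans)
    then show ?thesis by (intro exI[of _ 0]) simp
  next
    case False
    have "freely_reduced (p @ wpow y k @ inv_word p)"
      using red_v freely_reduced_wpow[OF yy, of k] False assms(2)
      unfolding v by (auto simp: freely_reduced_append hd_wpow last_wpow)
    moreover have "(p @ wpow y k @ inv_word p, wpow a m) \<in> pres_rel S {}"
      using pres_rel_conj_wpow[OF py assms(2), of "{}"] pres_rel_wpow[OF wv, of k] assms(4) v
      by (metis pres_rel.sym pres_rel.trans)
    moreover have "freely_reduced (wpow a m)"
      by (intro freely_reduced_wpow freely_reduced_distinct assms)
    ultimately have eq: "p @ wpow y k @ inv_word p = wpow a m"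
      by (intro freely_reduced_unique)
    \<comment> \<open>A letter of \<open>p\<close> would occur in \<open>a\<close> together with its
      inverse, although \<open>a\<close> uses each generator at most once.\<close>
    have "p = []"
    proof (rule ccontr)
      assume "p \<noteq> []"
      then obtain x p' where p: "p = x # p'" by (cases p) auto
      have "x \<in> set (wpow a m)" "letter_inv x \<in> set (wpow a m)"
        by (auto simp: p simp flip: eq)
      then have "x \<in> set a" "letter_inv x \<in> set a"
        by (meson set_wpow subsetD)+
      then have "x = letter_inv x"
        using assms(3) by (metis distinct_map inj_onD letter_inv_simps(2))
      then show False by simp
    qed
    then show ?thesis
      using eq wpow_eq_wpow_distinct[of y k a m] assms(2,3) wv v by (auto simp: distinct_map)
  qed
qed

section \<open>Normal forms in HNN extensions\<close>

text \<open>The single map \<phi> serves as both isomorphisms between the associated subgroups;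
  \<open>A e\<close> holds the elements that can be moved to the right past the stable letter with
  sign \<open>e\<close>.\<close>

locale hnn = group F for F :: "('a, 'b) monoid_scheme" (structure) +
  fixes A :: "bool \<Rightarrow> 'a set" and \<phi> :: "'a \<Rightarrow> 'a"
  assumes subgroup_A: "subgroup (A e) F"
    and phi_closed: "x \<in> A e \<Longrightarrow> \<phi> x \<in> A (\<not> e)"
    and phi_phi: "x \<in> A e \<Longrightarrow> \<phi> (\<phi> x) = x"
    and phi_mult: "x \<in> A e \<Longrightarrow> y \<in> A e \<Longrightarrow> \<phi> (x \<otimes> y) = \<phi> x \<otimes> \<phi> y"
begin

lemmas A_carrier = subgroup.mem_carrier[OF subgroup_A]
  and A_mult = subgroup.m_closed[OF subgroup_A]
  and A_inv = subgroup.m_inv_closed[OF subgroup_A]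
  and A_one = subgroup.one_closed[OF subgroup_A]

lemma A_mult_iff: "x \<in> carrier F \<Longrightarrow> c \<in> A e \<Longrightarrow> x \<otimes> c \<in> A e \<longleftrightarrow> x \<in> A e"
  by (metis A_carrier A_inv A_mult inv_solve_right')

lemma A_mult_left_iff: "x \<in> carrier F \<Longrightarrow> c \<in> A e \<Longrightarrow> c \<otimes> x \<in> A e \<longleftrightarrow> x \<in> A e"
  by (metis A_carrier A_inv A_mult inv_solve_left')

definition coset_rep :: "bool \<Rightarrow> 'a \<Rightarrow> 'a" where
  "coset_rep e f = (SOME r. r \<in> carrier F \<and> inv r \<otimes> f \<in> A e)"

lemma coset_rep:
  assumes "f \<in> carrier F"
  shows "coset_rep e f \<in> carrier F" "inv (coset_rep e f) \<otimes> f \<in> A e"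
  using someI[of "\<lambda>r. r \<in> carrier F \<and> inv r \<otimes> f \<in> A e" f] assms A_one
  by (auto simp: coset_rep_def l_inv)

text \<open>The condition defining a representative depends only on the left coset, so
  \<open>SOME\<close> makes the same choice for both elements.\<close>

lemma coset_rep_mult:
  assumes "f \<in> carrier F" "c \<in> A e" shows "coset_rep e (f \<otimes> c) = coset_rep e f"
proof -
  have "inv r \<otimes> (f \<otimes> c) \<in> A e \<longleftrightarrow> inv r \<otimes> f \<in> A e" if "r \<in> carrier F" for r
    using A_mult_iff[of "inv r \<otimes> f" c e] assms that A_carrier by (simp add: m_assoc)
  then show ?thesis
    unfolding coset_rep_def by meson
qed

lemma mult_inv_cancel:
  "x \<in> carrier F \<Longrightarrow> y \<in> carrier F \<Longrightarrow> x \<otimes> (inv x \<otimes> y) = y"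
  by (simp flip: m_assoc)

lemma coset_rep_idem: "f \<in> carrier F \<Longrightarrow> coset_rep e (coset_rep e f) = coset_rep e f"
  using coset_rep_mult[of "coset_rep e f" "inv (coset_rep e f) \<otimes> f" e] coset_rep[of f e]
  by (simp add: mult_inv_cancel)

lemma coset_rep_in_A_iff: "f \<in> carrier F \<Longrightarrow> coset_rep e f \<in> A e \<longleftrightarrow> f \<in> A e"
  using A_mult_iff[of "coset_rep e f" "inv (coset_rep e f) \<otimes> f" e] coset_rep[of f e]
  by (simp add: mult_inv_cancel)

text \<open>
  The state \<open>([(r\<^sub>n, e\<^sub>n), \<dots>, (r\<^sub>1, e\<^sub>1)], f)\<close> encodes the normal form
  \<open>r\<^sub>1 t\<^bsup>e\<^sub>1\<^esup> \<dots> r\<^sub>n t\<^bsup>e\<^sub>n\<^esup> f\<close>. Right multiplication by the stable letter uses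
  \<open>c t\<^bsup>e\<^esup> = t\<^bsup>e\<^esup> \<phi>(c)\<close> for \<open>c \<in> A e\<close>.
\<close>

fun shift :: "bool \<Rightarrow> ('a \<times> bool) list \<times> 'a \<Rightarrow> ('a \<times> bool) list \<times> 'a" where
  "shift e ((r, e') # L, f) =
    (if e' \<noteq> e \<and> f \<in> A e then (L, r \<otimes> \<phi> f)
     else ((coset_rep e f, e) # (r, e') # L, \<phi> (inv (coset_rep e f) \<otimes> f)))"
| "shift e ([], f) = ([(coset_rep e f, e)], \<phi> (inv (coset_rep e f) \<otimes> f))"

fun mulr :: "'a \<Rightarrow> ('a \<times> bool) list \<times> 'a \<Rightarrow> ('a \<times> bool) list \<times> 'a" where
  "mulr x (L, f) = (L, f \<otimes> x)"

text \<open>The head of the list is the rightmost syllable; the last clause excludes a pinch between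
  it and the stable letter before it.\<close>

fun normal_stack :: "('a \<times> bool) list \<Rightarrow> bool" where
  "normal_stack [] = True"
| "normal_stack ((r, e) # L) = (r \<in> carrier F \<and> coset_rep e r = r \<and> normal_stack L \<and>
    (case L of [] \<Rightarrow> True | (r', e') # L' \<Rightarrow> \<not> (e' \<noteq> e \<and> r \<in> A e)))"

definition normal_state :: "('a \<times> bool) list \<times> 'a \<Rightarrow> bool" where
  "normal_state z = (normal_stack (fst z) \<and> snd z \<in> carrier F)"

lemma normal_state_mulr: "normal_state z \<Longrightarrow> x \<in> carrier F \<Longrightarrow> normal_state (mulr x z)"
  by (cases z) (simp add: normal_state_def)

lemma phi_carrier: "x \<in> A e \<Longrightarrow> \<phi> x \<in> carrier F"
  using phi_closed A_carrier by blast

lemma normal_state_shift: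
  assumes "normal_state z" shows "normal_state (shift e z)"
proof (cases "(e, z)" rule: shift.cases)
  case (1 e r e' L f)
  then show ?thesis
    using assms coset_rep[of f e] coset_rep_idem[of f e] coset_rep_in_A_iff[of f e]
    by (auto simp: normal_state_def intro!: m_closed intro: phi_carrier split: list.splits)
next
  case (2 e f)
  then show ?thesis
    using assms coset_rep[of f e] coset_rep_idem[of f e]
    by (auto simp: normal_state_def intro: phi_carrier)
qed

text \<open>A pushed syllable is popped again because the remaining element is a \<phi>-image; a
  popped syllable is pushed again because its representative is recovered from the coset.\<close>

lemma shift_shift:
  assumes "normal_state z" shows "shift (\<not> e) (shift e z) = z"
proof -
  obtain L f where z: "z = (L, f)" by (cases z)
  then have f: "f \<in> carrier F" and L: "normal_stack L" using assms by (auto simp: normal_state_def)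
  let ?c = "inv (coset_rep e f) \<otimes> f"
  have push: "shift (\<not> e) ((coset_rep e f, e) # L, \<phi> ?c) = z"
    using coset_rep[OF f, of e] phi_closed phi_phi f by (auto simp: z mult_inv_cancel)
  show ?thesis
  proof (cases L)
    case Nil
    then show ?thesis using push by (simp add: z)
  next
    case (Cons x L')
    obtain r e' where x: "x = (r, e')" by (cases x)
    show ?thesis
    proof (cases "e' \<noteq> e \<and> f \<in> A e")
      case False
      then have "shift e z = ((coset_rep e f, e) # L, \<phi> ?c)" by (auto simp: z Cons x)
      then show ?thesis using push by simp
    next
      case True
      then have e': "e' = (\<not> e)" by auto
      have r: "r \<in> carrier F" "coset_rep (\<not> e) r = r"
        using L by (auto simp: Cons x e')
      have c: "\<phi> f \<in> A (\<not> e)" using True phi_closed by blast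
      have rep: "coset_rep (\<not> e) (r \<otimes> \<phi> f) = r"
        using coset_rep_mult r c by simp
      have "inv r \<otimes> (r \<otimes> \<phi> f) = \<phi> f"
        using r c A_carrier by (simp flip: m_assoc)
      \<comment> \<open>A second pop would need \<open>r\<close> in \<open>A (\<not> e)\<close>
        between stable letters of opposite sign, which normality of \<open>L\<close>
        forbids.\<close>
      moreover have "\<not> (fst (shift e z) \<noteq> [] \<and> snd (hd L') = e \<and> r \<otimes> \<phi> f \<in> A (\<not> e))"
        using L True A_mult_iff[OF r(1) c]
        by (auto simp: z Cons x e' split: list.splits prod.splits)
      ultimately show ?thesis
        using True rep phi_phi[of f e]
        by (cases L') (auto simp: z Cons x e')
    qed
  qed
qed

text \<open>Multiplying by an element of \<open>A e\<close> changes neither the coset of the last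
  entry nor its membership in \<open>A e\<close>, so \<open>shift\<close> takes the same branch with
  the same representative.\<close>

lemma shift_mulr:
  assumes "normal_state z" "c \<in> A e"
  shows "shift e (mulr c z) = mulr (\<phi> c) (shift e z)"
proof -
  obtain L f where z: "z = (L, f)" by (cases z)
  then have f: "f \<in> carrier F" and L: "normal_stack L" using assms by (auto simp: normal_state_def)
  have c: "c \<in> carrier F" using assms A_carrier by blast
  have "inv (coset_rep e f) \<otimes> (f \<otimes> c) = (inv (coset_rep e f) \<otimes> f) \<otimes> c"
    using f c coset_rep(1)[OF f] by (simp add: m_assoc)
  then have push: "\<phi> (inv (coset_rep e (f \<otimes> c)) \<otimes> (f \<otimes> c)) = \<phi> (inv (coset_rep e f) \<otimes> f) \<otimes> \<phi> c"
    using phi_mult[OF coset_rep(2)[OF f] assms(2)] coset_rep_mult[OF f assms(2)] by simp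
  have pop: "r \<otimes> \<phi> (f \<otimes> c) = r \<otimes> \<phi> f \<otimes> \<phi> c" if "f \<in> A e" "r \<in> carrier F" for r
    using that assms(2) phi_mult phi_carrier by (simp add: m_assoc)
  show ?thesis
  proof (cases L)
    case (Cons x L')
    then show ?thesis
      using push pop L A_mult_iff[OF f assms(2)] coset_rep_mult[OF f assms(2)]
      by (cases x) (auto simp: z)
  qed (use push coset_rep_mult[OF f assms(2)] in \<open>auto simp: z\<close>)
qed

lemma length_shift_le: "length (fst (shift e z)) \<le> length (fst z) + 1"
  by (cases "(e, z)" rule: shift.cases) auto

end

section \<open>One-relator presentations with a stable letter\<close>

text \<open>
  In the presented group \<open>t a t\<^sup>-\<^sup>1 = rev a\<close>, an HNN relation over the free group on the other
  letters in which both associated words have the same length.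
\<close>

locale stable_letter =
  fixes S :: "'s set" and t :: 's and a \<alpha> \<gamma> :: "'s word"
  assumes t_in: "t \<in> S"
    and words_a: "a \<in> words (S - {t})"
    and words_\<alpha>: "\<alpha> \<in> words (S - {t})"
    and words_\<gamma>: "\<gamma> \<in> words (S - {t})"
    and distinct_a: "distinct (map fst a)"
    and rev_a: "rev a = inv_word (\<gamma> @ \<alpha>)"
begin

abbreviation "R \<equiv> {\<alpha> @ [(t, True)] @ a @ [(t, False)] @ \<gamma>}"
abbreviation "F \<equiv> presented_group (S - {t}) {}"
abbreviation "cl w \<equiv> pres_rel (S - {t}) {} `` {w}"

text \<open>The indexing follows from t a t^-1 = \<open>rev a\<close>: powers of
  \<open>rev a\<close> move to the right past t, powers of \<open>a\<close> past t^-1.\<close>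

definition base :: "bool \<Rightarrow> 's word" where
  "base e = (if e then rev a else a)"

definition A :: "bool \<Rightarrow> 's word set set" where
  "A e = {cl (base e) [^]\<^bsub>F\<^esub> (k :: int) | k. True}"

lemma words_base [simp]: "base e \<in> words (S - {t})"
  by (simp add: base_def words_a)

lemma distinct_base: "distinct (map fst (base e))"
  by (simp add: base_def distinct_a flip: rev_map)

lemma rev_base: "rev (base e) = base (\<not> e)"
  by (simp add: base_def)

lemma words_mono: "w \<in> words (S - {t}) \<Longrightarrow> w \<in> words S"
  by (auto simp: words_def lists_eq_set)

lemma cl_eq_iff:
  "v \<in> words (S - {t}) \<Longrightarrow> w \<in> words (S - {t}) \<Longrightarrow>
    cl v = cl w \<longleftrightarrow> (v, w) \<in> pres_rel (S - {t}) {}"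
  using eq_equiv_class_iff[OF equiv_pres_rel] by blast

lemma cl_inv:
  assumes "w \<in> words (S - {t})" shows "inv\<^bsub>F\<^esub> (cl w) = cl (inv_word w)"
proof -
  have "cl (inv_word w @ w) = cl []"
    using assms by (subst cl_eq_iff) (auto intro: pres_rel_inv_word)
  then have "cl (inv_word w) \<otimes>\<^bsub>F\<^esub> cl w = \<one>\<^bsub>F\<^esub>"
    using assms by (simp add: presented_mult presented_one)
  then show ?thesis
    using assms by (intro group.inv_equality[OF group_presented_group]) simp_all
qed

lemma cl_nat_pow: "w \<in> words (S - {t}) \<Longrightarrow> cl w [^]\<^bsub>F\<^esub> (n :: nat) = cl (wpow w n)"
  by (rule presented_nat_pow)

lemma cl_int_pow:
  assumes "w \<in> words (S - {t})"
  shows "cl w [^]\<^bsub>F\<^esub> (k :: int) =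
    (if k < 0 then cl (wpow (inv_word w) (nat (- k))) else cl (wpow w (nat k)))"
  unfolding int_pow_def2 cl_nat_pow[OF assms] cl_inv[OF words_wpow[OF assms]] inv_word_wpow ..

text \<open>Natural powers of a word or of its inverse replace integer exponents, which is the form
  that \<open>free_root\<close> can handle.\<close>

lemma A_iff: "X \<in> A e \<longleftrightarrow> (\<exists>c m. c \<in> {base e, inv_word (base e)} \<and> X = cl (wpow c m))"
proof
  assume "X \<in> A e"
  then obtain k :: int where "X = cl (base e) [^]\<^bsub>F\<^esub> k"
    unfolding A_def by blast
  then show "\<exists>c m. c \<in> {base e, inv_word (base e)} \<and> X = cl (wpow c m)"
    by (cases "k < 0") (auto simp only: cl_int_pow words_base if_True if_False)
next
  assume "\<exists>c m. c \<in> {base e, inv_word (base e)} \<and> X = cl (wpow c m)"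
  then obtain c m where c: "c \<in> {base e, inv_word (base e)}" "X = cl (wpow c m)" by blast
  define k where "k = (if c = base e then int m else - int m)"
  have "X = cl (base e) [^]\<^bsub>F\<^esub> k"
    using c by (cases "m = 0") (auto simp: cl_int_pow k_def)
  then show "X \<in> A e"
    unfolding A_def by blast
qed

lemma rev_cl:
  assumes "w \<in> words (S - {t})" shows "rev ` cl w = cl (rev w)"
proof
  show "rev ` cl w \<subseteq> cl (rev w)"
    by (auto intro: pres_rel_rev)
  show "cl (rev w) \<subseteq> rev ` cl w"
  proof
    fix v assume "v \<in> cl (rev w)"
    then have "rev v \<in> cl w"
      using pres_rel_rev[of "rev w" v "S - {t}"] by simp
    then show "v \<in> rev ` cl w"
      using image_eqI[of v rev "rev v" "cl w"] by simp
  qed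
qed

text \<open>Reversal is an anti-automorphism of the free group exchanging \<open>a\<close> and
  \<open>rev a\<close>. It is multiplicative on each \<open>A e\<close> because a cyclic group is
  commutative.\<close>

sublocale hnn F A "image rev"
proof (intro hnn.intro hnn_axioms.intro group_presented_group)
  interpret F: group F by (rule group_presented_group)
  fix e x y
  show "subgroup (A e) F"
  proof (rule F.subgroupI)
    show "A e \<subseteq> carrier F" "A e \<noteq> {}"
      by (auto simp: A_def)
    show "inv\<^bsub>F\<^esub> x \<in> A e" if "x \<in> A e" for x
      using that by (auto simp: A_def simp flip: F.int_pow_neg)
    show "x \<otimes>\<^bsub>F\<^esub> y \<in> A e" if "x \<in> A e" "y \<in> A e" for x y
      using that by (auto simp: A_def simp flip: F.int_pow_mult)
  qed
  have closed: "rev ` x \<in> A (\<not> e)" if x: "x \<in> A e" for e x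
  proof -
    obtain c m where c: "c \<in> {base e, inv_word (base e)}" "x = cl (wpow c m)"
      using x A_iff by blast
    then have cw: "c \<in> words (S - {t})" by auto
    then have "rev ` x = cl (wpow (rev c) m)"
      unfolding c(2) by (simp add: rev_cl words_wpow rev_wpow)
    moreover have "rev c \<in> {base (\<not> e), inv_word (base (\<not> e))}"
      using c(1) by (auto simp: rev_inv_word rev_base)
    ultimately show ?thesis using A_iff by blast
  qed
  show "rev ` x \<in> A (\<not> e)" if "x \<in> A e"
    using closed that .
  show "rev ` rev ` x = x"
    by (simp add: image_image)
  show "rev ` (x \<otimes>\<^bsub>F\<^esub> y) = rev ` x \<otimes>\<^bsub>F\<^esub> rev ` y" if xy: "x \<in> A e" "y \<in> A e"
  proof -
    have "x \<in> carrier F" "y \<in> carrier F"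
      using xy by (auto simp: A_def)
    then obtain u v where uv: "u \<in> words (S - {t})" "x = cl u" "v \<in> words (S - {t})" "y = cl v"
      by (meson presented_carrierE)
    have "rev ` (x \<otimes>\<^bsub>F\<^esub> y) = rev ` y \<otimes>\<^bsub>F\<^esub> rev ` x"
      using uv by (simp add: presented_mult rev_cl)
    also have "\<dots> = rev ` x \<otimes>\<^bsub>F\<^esub> rev ` y"
      using closed[OF xy(1)] closed[OF xy(2)]
      by (auto simp: A_def add.commute simp flip: F.int_pow_mult)
    finally show ?thesis .
  qed
qed

section \<open>The right action of the presented group on normal states\<close>

definition step :: "'s \<times> bool \<Rightarrow> ('s word set \<times> bool) list \<times> 's word set \<Rightarrow>
    ('s word set \<times> bool) list \<times> 's word set" where
  "step x z = (if fst x = t then shift (snd x) z else mulr (cl [x]) z)"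

lemma normal_state_step: "fst x \<in> S \<Longrightarrow> normal_state z \<Longrightarrow> normal_state (step x z)"
  by (simp add: step_def normal_state_shift normal_state_mulr)

lemma normal_state_fold:
  "w \<in> words S \<Longrightarrow> normal_state z \<Longrightarrow> normal_state (fold step w z)"
proof (induction w arbitrary: z)
  case (Cons x w)
  then show ?case using normal_state_step[of x z] by simp
qed simp

lemma mulr_mulr:
  "normal_state z \<Longrightarrow> u \<in> words (S - {t}) \<Longrightarrow> v \<in> words (S - {t}) \<Longrightarrow>
    mulr (cl v) (mulr (cl u) z) = mulr (cl (u @ v)) z"
  by (cases z) (simp add: normal_state_def m_assoc flip: presented_mult)

lemma mulr_Nil: "normal_state z \<Longrightarrow> mulr (cl []) z = z"
  by (cases z) (simp add: normal_state_def flip: presented_one)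

lemma fold_step_free:
  "w \<in> words (S - {t}) \<Longrightarrow> normal_state z \<Longrightarrow> fold step w z = mulr (cl w) z"
proof (induction w arbitrary: z)
  case (Cons x w)
  then show ?case
    using mulr_mulr[of z "[x]" w] by (simp add: step_def normal_state_mulr)
qed (simp add: mulr_Nil)

text \<open>By \<open>shift_mulr\<close>, acting by \<open>a\<close> after the shift is acting by
  \<open>rev a\<close> before it; then the two shifts cancel. What remains is \<alpha>
  \<open>rev a\<close> \<gamma>, trivial in the free group by \<open>rev_a\<close>.\<close>

lemma fold_step_relator:
  assumes z: "normal_state z"
  shows "fold step (\<alpha> @ [(t, True)] @ a @ [(t, False)] @ \<gamma>) z = z"
proof -
  let ?z = "mulr (cl \<alpha>) z"
  have z1: "normal_state ?z"
    using z words_\<alpha> by (simp add: normal_state_mulr)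
  have rA: "cl (rev a) \<in> A True"
    unfolding A_iff by (auto simp: base_def intro!: exI[of _ "rev a"] exI[of _ 1])
  have z2: "normal_state (mulr (cl (rev a)) ?z)"
    using z1 words_a by (simp add: normal_state_mulr)
  have "fold step a (shift True ?z) = mulr (rev ` cl (rev a)) (shift True ?z)"
    using z1 words_a by (simp add: fold_step_free normal_state_shift rev_cl)
  also have "\<dots> = shift True (mulr (cl (rev a)) ?z)"
    using shift_mulr[OF z1 rA] by simp
  finally have "fold step (\<alpha> @ [(t, True)] @ a @ [(t, False)]) z = mulr (cl (rev a)) ?z"
    using z words_\<alpha> shift_shift[OF z2, of True] by (simp add: fold_step_free step_def)
  then have "fold step (\<alpha> @ [(t, True)] @ a @ [(t, False)] @ \<gamma>) z = mulr (cl ((\<alpha> @ rev a) @ \<gamma>)) z"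
    using z z2 words_\<alpha> words_a words_\<gamma> by (simp add: fold_step_free mulr_mulr)
  also have "cl ((\<alpha> @ rev a) @ \<gamma>) = cl []"
  proof (subst cl_eq_iff)
    have "(((\<alpha> @ inv_word \<alpha>) @ (inv_word \<gamma> @ \<gamma>)), [] @ []) \<in> pres_rel (S - {t}) {}"
      by (intro pres_rel_append pres_rel_inv_word pres_rel_inv_word_right words_\<alpha> words_\<gamma>)
    then show "((\<alpha> @ rev a) @ \<gamma>, []) \<in> pres_rel (S - {t}) {}"
      by (simp add: rev_a)
  qed (use words_\<alpha> words_a words_\<gamma> in auto)
  finally show ?thesis
    using mulr_Nil[OF z] by simp
qed

lemma fold_step_pres_rel:
  assumes "(v, w) \<in> pres_rel S R" "normal_state z"
  shows "fold step v z = fold step w z"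
  using assms
proof (induction arbitrary: z rule: pres_rel.induct)
  case (cancel u v s b)
  define z' where "z' = fold step u z"
  have z': "normal_state z'"
    using cancel by (simp add: z'_def normal_state_fold)
  have "fold step [(s, b), (s, \<not> b)] z' = z'"
  proof (cases "s = t")
    case True
    then show ?thesis using shift_shift[OF z', of b] by (simp add: step_def)
  next
    case False
    have "cl [(s, b), (s, \<not> b)] = cl []"
      using pres_rel.cancel[of "[]" "S - {t}" "[]" s b "{}"] cancel(3) False
      by (subst cl_eq_iff) auto
    then show ?thesis
      using fold_step_free[OF _ z', of "[(s, b), (s, \<not> b)]"] cancel(3) False mulr_Nil[OF z'] by simp
  qed
  then show ?case
    by (simp add: z'_def)
next
  case (relator u v r)
  then have "fold step r (fold step u z) = fold step u z"
    using fold_step_relator[OF normal_state_fold] by auto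
  then show ?case by simp
qed auto

text \<open>The HNN length: the number of stable letters in the normal form. It depends only on the
  group element since equivalent words act alike on normal states.\<close>

definition tlength :: "'s word \<Rightarrow> nat" where
  "tlength w = length (fst (fold step w ([], \<one>\<^bsub>F\<^esub>)))"

definition tcount :: "'s word \<Rightarrow> nat" where
  "tcount w = count_list (map fst w) t"

lemma normal_state_init: "normal_state ([], \<one>\<^bsub>F\<^esub>)"
  by (simp add: normal_state_def)

lemma tlength_pres_rel: "(v, w) \<in> pres_rel S R \<Longrightarrow> tlength v = tlength w"
  by (simp add: tlength_def fold_step_pres_rel normal_state_init)

lemma tcount_simps [simp]:
  "tcount [] = 0"
  "tcount (x # w) = (if fst x = t then 1 else 0) + tcount w"
  "tcount (v @ w) = tcount v + tcount w"
  "tcount (rev w) = tcount w"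
  "tcount (inv_word w) = tcount w"
  by (auto simp: tcount_def map_fst_inv_word simp flip: rev_map)

lemma tcount_wpow [simp]: "tcount (wpow w k) = k * tcount w"
  by (induction k) auto

lemma tcount_eq_0: "w \<in> words S \<Longrightarrow> tcount w = 0 \<longleftrightarrow> w \<in> words (S - {t})"
  by (induction w) auto

lemma tlength_le_tcount: "tlength w \<le> tcount w"
proof -
  have "length (fst (fold step w z)) \<le> length (fst z) + tcount w" for z
  proof (induction w arbitrary: z)
    case (Cons x w)
    have "length (fst (step x z)) \<le> length (fst z) + (if fst x = t then 1 else 0)"
      using length_shift_le[of "snd x" z] by (cases z) (simp add: step_def)
    then show ?case
      using Cons[of "step x z"] by simp
  qed simp
  from this[of "([], \<one>\<^bsub>F\<^esub>)"] show ?thesis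
    by (simp add: tlength_def)
qed

subsection \<open>Pinches\<close>

lemma relator_pres_rel: "([(t, True)] @ a @ [(t, False)], rev a) \<in> pres_rel S R"
proof -
  have "([] @ (\<alpha> @ [(t, True)] @ a @ [(t, False)] @ \<gamma>) @ [], [] @ []) \<in> pres_rel S R"
    by (intro pres_rel.relator)
      (use t_in words_a words_\<alpha> words_\<gamma> in \<open>auto intro: words_mono\<close>)
  then have "(\<alpha> @ ([(t, True)] @ a @ [(t, False)] @ \<gamma>), []) \<in> pres_rel S R"
    by simp
  then have "([(t, True)] @ a @ [(t, False)] @ \<gamma>, inv_word \<alpha> @ []) \<in> pres_rel S R"
    by (rule pres_rel_cancel_left)
  then have "(([(t, True)] @ a @ [(t, False)]) @ \<gamma>, inv_word \<alpha>) \<in> pres_rel S R"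
    by simp
  then show ?thesis
    using pres_rel_cancel_right rev_a by fastforce
qed

lemma slide_base: "(base e @ [(t, e)], [(t, e)] @ base (\<not> e)) \<in> pres_rel S R"
proof (cases e)
  case True
  have "([(t, True)] @ a, rev a @ inv_word [(t, False)]) \<in> pres_rel S R"
    using relator_pres_rel by (intro pres_rel_cancel_right) simp
  then show ?thesis
    using True by (auto simp: base_def letter_inv_def intro: pres_rel.sym)
next
  case False
  have "(a @ [(t, False)], inv_word [(t, True)] @ rev a) \<in> pres_rel S R"
    using relator_pres_rel by (intro pres_rel_cancel_left) simp
  then show ?thesis
    using False by (auto simp: base_def letter_inv_def)
qed

lemma slide_inv:
  assumes "(c @ u, u @ d) \<in> pres_rel S R"
  shows "(inv_word c @ u, u @ inv_word d) \<in> pres_rel S R"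
proof -
  have "(u, (c @ u) @ inv_word d) \<in> pres_rel S R"
    by (intro pres_rel_cancel_right pres_rel.sym[OF assms])
  then have "(c @ (u @ inv_word d), u) \<in> pres_rel S R"
    by (auto intro: pres_rel.sym)
  then show ?thesis
    by (intro pres_rel.sym[OF pres_rel_cancel_left])
qed

lemma slide_wpow:
  assumes "(c @ u, u @ d) \<in> pres_rel S R"
  shows "(wpow c m @ u, u @ wpow d m) \<in> pres_rel S R"
proof -
  have cud: "c \<in> words S" "u \<in> words S" "d \<in> words S"
    using pres_rel_words[OF assms] by auto
  show ?thesis
  proof (induction m)
    case 0
    then show ?case using cud by (auto intro: pres_rel.refl)
  next
    case (Suc m)
    have "(c @ (wpow c m @ u), c @ (u @ wpow d m)) \<in> pres_rel S R"
      using cud by (intro pres_rel_append Suc pres_rel.refl)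
    moreover have "((c @ u) @ wpow d m, (u @ d) @ wpow d m) \<in> pres_rel S R"
      using cud by (intro pres_rel_append assms pres_rel.refl words_wpow)
    ultimately show ?case
      by (auto intro: pres_rel.trans)
  qed
qed

lemma pres_rel_free: "(v, w) \<in> pres_rel (S - {t}) {} \<Longrightarrow> (v, w) \<in> pres_rel S R"
  by (rule pres_rel_mono) auto

text \<open>\<open>f\<close> is exchanged for a power of the base word, which moves past the stable
  letter factor by factor. Since reversal respects free equivalence, the result can be exchanged
  back for \<open>rev f\<close>, a word as long as \<open>f\<close>.\<close>

lemma slide:
  assumes "f \<in> words (S - {t})" "cl f \<in> A e"
  shows "(f @ [(t, e)], [(t, e)] @ rev f) \<in> pres_rel S R"
proof -
  obtain c m where c: "c \<in> {base e, inv_word (base e)}" "cl f = cl (wpow c m)"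
    using assms(2) A_iff by blast
  have "(base e @ [(t, e)], [(t, e)] @ rev (base e)) \<in> pres_rel S R"
    using slide_base[of e] by (simp add: rev_base)
  then have "(c @ [(t, e)], [(t, e)] @ rev c) \<in> pres_rel S R"
    using c(1) slide_inv[of "base e" "[(t, e)]" "rev (base e)"] by (auto simp: rev_inv_word)
  then have *: "(wpow c m @ [(t, e)], [(t, e)] @ wpow (rev c) m) \<in> pres_rel S R"
    by (rule slide_wpow)
  have "c \<in> words (S - {t})"
    using c(1) by auto
  then have f: "(f, wpow c m) \<in> pres_rel (S - {t}) {}"
    using c(2) assms(1) cl_eq_iff words_wpow by blast
  have t: "[(t, e)] \<in> words S" using t_in by simp
  have "(f @ [(t, e)], wpow c m @ [(t, e)]) \<in> pres_rel S R"
    using f t by (intro pres_rel_append pres_rel_free pres_rel.refl)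
  moreover have "([(t, e)] @ wpow (rev c) m, [(t, e)] @ rev f) \<in> pres_rel S R"
    using pres_rel_rev[OF f] t
    by (intro pres_rel_append pres_rel_free pres_rel.refl) (auto simp: rev_wpow intro: pres_rel.sym)
  ultimately show ?thesis
    using * by (blast intro: pres_rel.trans)
qed

text \<open>Replacing a pinch by \<open>rev f\<close> removes exactly the two stable letters, so
  both the total length and the count of t drop by two.\<close>

lemma pinch_pres_rel:
  assumes "f \<in> words (S - {t})" "cl f \<in> A (\<not> e)"
  shows "([(t, e)] @ f @ [(t, \<not> e)], rev f) \<in> pres_rel S R"
proof -
  have "((f @ [(t, \<not> e)]), inv_word [(t, e)] @ rev f) \<in> pres_rel S R"
    using slide[OF assms] by (simp add: letter_inv_def)
  then have "(inv_word (inv_word [(t, e)]) @ f @ [(t, \<not> e)], rev f) \<in> pres_rel S R"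
    by (meson pres_rel.sym pres_rel_cancel_left)
  then show ?thesis by simp
qed

text \<open>
  Scanning a word from left to right, \<open>Some (e, f)\<close> means that \<open>f\<close> is the part read after the last
  occurrence \<open>t\<^bsup>e\<^esup>\<close> of the stable letter.
\<close>

definition scan :: "'s \<times> bool \<Rightarrow> (bool \<times> 's word) option \<Rightarrow> (bool \<times> 's word) option" where
  "scan x z = (if fst x = t then Some (snd x, []) else map_option (\<lambda>(e, f). (e, f @ [x])) z)"

lemma scan_simps [simp]:
  "fst x = t \<Longrightarrow> scan x z = Some (snd x, [])"
  "fst x \<noteq> t \<Longrightarrow> scan x z = map_option (\<lambda>(e, f). (e, f @ [x])) z"
  by (simp_all add: scan_def)

definition pinch_at :: "(bool \<times> 's word) option \<Rightarrow> 's \<times> bool \<Rightarrow> bool" where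
  "pinch_at z x \<longleftrightarrow> fst x = t \<and> (\<exists>e f. z = Some (e, f) \<and> snd x \<noteq> e \<and> cl f \<in> A (snd x))"

text \<open>The first argument is the scan state left by a preceding word, so that a factor can be
  tested inside a product; \<open>None\<close> means that no stable letter has been read.\<close>

fun pinch_free :: "(bool \<times> 's word) option \<Rightarrow> 's word \<Rightarrow> bool" where
  "pinch_free z [] = True"
| "pinch_free z (x # w) = (\<not> pinch_at z x \<and> pinch_free (scan x z) w)"

lemma pinch_free_append:
  "pinch_free z (v @ w) \<longleftrightarrow> pinch_free z v \<and> pinch_free (fold scan v z) w"
  by (induction v arbitrary: z) auto

lemma fold_scan_free:
  "w \<in> words (S - {t}) \<Longrightarrow> fold scan w z = map_option (\<lambda>(e, f). (e, f @ w)) z"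
  by (induction w arbitrary: z)
    (auto simp: option.map_comp comp_def case_prod_unfold option.map_ident)

lemma pinch_free_free: "w \<in> words (S - {t}) \<Longrightarrow> pinch_free z w"
  by (induction w arbitrary: z) (auto simp: pinch_at_def)

lemma fold_scan_Some:
  "w \<in> words S \<Longrightarrow> fold scan w None = Some (e, f) \<Longrightarrow>
    f \<in> words (S - {t}) \<and> (\<exists>p. w = p @ [(t, e)] @ f)"
proof (induction w arbitrary: e f rule: rev_induct)
  case (snoc x w)
  then show ?case
    by (cases "fst x = t") (auto simp: prod_eq_iff)
qed simp

lemma not_pinch_free:
  "w \<in> words S \<Longrightarrow> \<not> pinch_free None w \<Longrightarrow>
    \<exists>p e f q. w = p @ ([(t, e)] @ f @ [(t, \<not> e)]) @ q \<and> f \<in> words (S - {t}) \<and> cl f \<in> A (\<not> e)"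
proof (induction w rule: rev_induct)
  case (snoc x w)
  show ?case
  proof (cases "pinch_free None w")
    case False
    then obtain p e f q where "w = p @ ([(t, e)] @ f @ [(t, \<not> e)]) @ q"
        "f \<in> words (S - {t})" "cl f \<in> A (\<not> e)"
      using snoc by auto
    then show ?thesis
      by (intro exI[of _ p] exI[of _ e] exI[of _ f] exI[of _ "q @ [x]"]) simp
  next
    case True
    then have "pinch_at (fold scan w None) x"
      using snoc.prems by (simp add: pinch_free_append)
    then obtain e f where x: "fold scan w None = Some (e, f)" "x = (t, \<not> e)" "cl f \<in> A (\<not> e)"
      by (cases x) (auto simp: pinch_at_def)
    then obtain p where "f \<in> words (S - {t})" "w = p @ [(t, e)] @ f"
      using fold_scan_Some[of w e f] snoc.prems by auto
    with x show ?thesis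
      by (intro exI[of _ p] exI[of _ e] exI[of _ f] exI[of _ "[]"]) simp
  qed
qed simp

lemma not_pinch_free_shorten:
  assumes "w \<in> words S" "\<not> pinch_free None w"
  obtains v where "(w, v) \<in> pres_rel S R" "length v < length w" "tcount v < tcount w"
proof -
  obtain p e f q where w: "w = p @ ([(t, e)] @ f @ [(t, \<not> e)]) @ q" "f \<in> words (S - {t})"
      "cl f \<in> A (\<not> e)"
    using not_pinch_free[OF assms] by blast
  have "(w, p @ rev f @ q) \<in> pres_rel S R"
    unfolding w(1) using assms(1) w by (intro pres_rel_context pinch_pres_rel) auto
  then show ?thesis
    by (rule that) (simp_all add: w(1))
qed

text \<open>Britton's lemma: without pinches no stable letter ever pops the stack, so each one adds
  a syllable.\<close>

lemma pinch_free_tlength: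
  assumes "w \<in> words S" "pinch_free None w" shows "tlength w = tcount w"
proof -
  let ?z = "\<lambda>w. fold step w ([], \<one>\<^bsub>F\<^esub>)"
  \<comment> \<open>The last entry of the state differs from the class of \<open>f\<close> only by a
    left factor in \<open>A (\<not> e)\<close>, the subgroup that decides whether a stable letter of
    opposite sign pops.\<close>
  have "length (fst (?z w)) = tcount w \<and>
    (case fold scan w None of None \<Rightarrow> fst (?z w) = []
      | Some (e, f) \<Rightarrow> \<exists>r L c. fst (?z w) = (r, e) # L \<and> c \<in> A (\<not> e) \<and> snd (?z w) = c \<otimes>\<^bsub>F\<^esub> cl f)"
    using assms
  proof (induction w rule: rev_induct)
    case (snoc x w)
    obtain L g where z: "?z w = (L, g)" by (cases "?z w")
    have w: "w \<in> words S" "pinch_free None w" and np: "\<not> pinch_at (fold scan w None) x"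
      using snoc.prems by (auto simp: pinch_free_append)
    have "normal_state (?z w)"
      using w normal_state_fold normal_state_init by blast
    then have g: "g \<in> carrier F"
      by (simp add: z normal_state_def)
    note IH = snoc.IH[OF w, unfolded z fst_conv snd_conv]
    show ?case
    proof (cases "fst x = t")
      case False
      then have x: "[x] \<in> words (S - {t})" using snoc.prems by simp
      have "(c \<otimes>\<^bsub>F\<^esub> cl f) \<otimes>\<^bsub>F\<^esub> cl [x] = c \<otimes>\<^bsub>F\<^esub> cl (f @ [x])"
        if "fold scan w None = Some (e, f)" "c \<in> A (\<not> e)" for c e f
        using fold_scan_Some[OF w(1) that(1)] x A_carrier[OF that(2)]
        by (simp add: m_assoc presented_mult)
      then show ?thesis
        using IH False by (auto simp: step_def[of x] z split: option.splits)
    next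
      case True
      define e' where "e' = snd x"
      have no_pop: "shift e' (L, g) =
          ((coset_rep e' g, e') # L, rev ` (inv\<^bsub>F\<^esub> (coset_rep e' g) \<otimes>\<^bsub>F\<^esub> g))"
      proof (cases "fold scan w None")
        case None
        then show ?thesis using IH by simp
      next
        case (Some ef)
        obtain e f where ef: "ef = (e, f)" by (cases ef)
        then obtain r L' c where L: "L = (r, e) # L'" "c \<in> A (\<not> e)" "g = c \<otimes>\<^bsub>F\<^esub> cl f"
          using IH Some by auto
        have "f \<in> words (S - {t})"
          using fold_scan_Some w Some ef by blast
        then have "g \<in> A e' \<longleftrightarrow> cl f \<in> A e'" if "e \<noteq> e'"
          using A_mult_left_iff[of "cl f" c e'] L that by (cases e; cases e') auto
        moreover have "\<not> (e' \<noteq> e \<and> cl f \<in> A e')"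
          using np True Some ef by (auto simp: pinch_at_def e'_def)
        ultimately show ?thesis
          by (auto simp: L(1))
      qed
      \<comment> \<open>The factor required by the invariant is the \<phi>-image of the coset
        remainder, with nothing read after the new stable letter.\<close>
      have "rev ` (inv\<^bsub>F\<^esub> (coset_rep e' g) \<otimes>\<^bsub>F\<^esub> g) \<in> A (\<not> e')"
        using coset_rep(2)[OF g] phi_closed by blast
      moreover from this have "c \<otimes>\<^bsub>F\<^esub> cl [] = c"
        if "c = rev ` (inv\<^bsub>F\<^esub> (coset_rep e' g) \<otimes>\<^bsub>F\<^esub> g)" for c
        using that A_carrier by (simp flip: presented_one)
      ultimately show ?thesis
        using IH True no_pop by (auto simp: step_def[of x] z simp flip: e'_def)
    qed
  qed simp
  then show ?thesis by (simp add: tlength_def)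
qed

lemma pinch_free_iff: "w \<in> words S \<Longrightarrow> pinch_free None w \<longleftrightarrow> tlength w = tcount w"
  by (metis not_pinch_free_shorten pinch_free_tlength tlength_pres_rel tlength_le_tcount leD)

text \<open>The hypothesis compares total lengths and does not refer to t, so one shortest word
  minimises the counts of all generators at once.\<close>

lemma shortest_tcount:
  assumes "w \<in> words S" "\<And>v. (w, v) \<in> pres_rel S R \<Longrightarrow> length w \<le> length v"
  shows "tcount w = tlength w"
  using assms by (metis not_pinch_free_shorten pinch_free_tlength leD)

lemma ex_tcount_eq_tlength:
  assumes "w \<in> words S" shows "\<exists>v. (w, v) \<in> pres_rel S R \<and> tcount v = tlength w"
proof -
  obtain v where v: "(w, v) \<in> pres_rel S R" "\<And>u. (w, u) \<in> pres_rel S R \<Longrightarrow> tcount v \<le> tcount u"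
    using ex_has_least_nat[of "\<lambda>v. (w, v) \<in> pres_rel S R" w tcount] assms pres_rel.refl by metis
  have "v \<in> words S" using v(1) pres_rel_words by blast
  moreover have "pinch_free None v"
    using v pres_rel.trans not_pinch_free_shorten[OF \<open>v \<in> words S\<close>] by (metis leD)
  ultimately show ?thesis
    using v(1) pinch_free_tlength tlength_pres_rel by metis
qed

subsection \<open>Powers\<close>

text \<open>The base word and its inverse use each generator at most once, so
  \<open>free_root\<close> applies to both.\<close>

lemma A_root:
  assumes "f \<in> words (S - {t})" "k \<ge> 1" "cl (wpow f k) \<in> A e"
  shows "cl f \<in> A e"
proof -
  obtain c m where c: "c \<in> {base e, inv_word (base e)}" "cl (wpow f k) = cl (wpow c m)"
    using assms(3) A_iff by blast
  then have cw: "c \<in> words (S - {t})" and "distinct (map fst c)"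
    using distinct_base by (auto simp: map_fst_inv_word)
  moreover have "(wpow f k, wpow c m) \<in> pres_rel (S - {t}) {}"
    using c(2) cw assms(1) cl_eq_iff words_wpow by blast
  ultimately obtain l where "(f, wpow c l) \<in> pres_rel (S - {t}) {}"
    using free_root assms(1,2) by blast
  then have "cl f = cl (wpow c l)"
    using cw assms(1) by (subst cl_eq_iff) (auto intro: words_wpow)
  then show ?thesis
    using c(1) A_iff by blast
qed

lemma A_root_conj:
  assumes "q \<in> words (S - {t})" "y \<in> words (S - {t})" "k \<ge> 1"
    and "cl (q @ wpow y k @ inv_word q) \<in> A e"
  shows "cl (q @ y @ inv_word q) \<in> A e"
proof (rule A_root)
  have "cl (wpow (q @ y @ inv_word q) k) = cl (q @ wpow y k @ inv_word q)"
    using assms by (subst cl_eq_iff) (auto intro: words_wpow pres_rel_conj_wpow)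
  then show "cl (wpow (q @ y @ inv_word q) k) \<in> A e"
    using assms(4) by simp
qed (use assms in auto)

lemma fold_scan_None: "w \<in> words S \<Longrightarrow> fold scan w None = None \<Longrightarrow> w \<in> words (S - {t})"
proof (induction w rule: rev_induct)
  case (snoc x w)
  then show ?case by (cases "fst x = t") auto
qed simp

lemma split_first_stable:
  "w \<in> words S \<Longrightarrow> tcount w > 0 \<Longrightarrow> \<exists>p e q. w = p @ [(t, e)] @ q \<and> p \<in> words (S - {t})"
proof (induction w)
  case (Cons x w)
  show ?case
  proof (cases "fst x = t")
    case True
    then show ?thesis
      by (intro exI[of _ "[]"] exI[of _ "snd x"] exI[of _ w]) (auto simp: prod_eq_iff)
  next
    case False
    then obtain p e q where "w = p @ [(t, e)] @ q" "p \<in> words (S - {t})"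
      using Cons by auto
    then show ?thesis
      using False Cons.prems by (intro exI[of _ "x # p"] exI[of _ e] exI[of _ q]) auto
  qed
qed simp

text \<open>A new pinch could only arise between the last stable letter of \<open>P\<close> and its
  inverse. By closure under roots it would already be present for the exponent 1.\<close>

lemma pinch_free_conj_wpow_elliptic:
  assumes "P \<in> words S" "y \<in> words (S - {t})" "k \<ge> 1"
    and pf: "pinch_free None (P @ y @ inv_word P)"
  shows "pinch_free None (P @ wpow y k @ inv_word P)"
proof (cases "fold scan P None")
  case None
  then have "P \<in> words (S - {t})"
    using assms(1) fold_scan_None by blast
  then show ?thesis
    using assms(2) by (intro pinch_free_free) (auto intro: words_wpow)
next
  case (Some eq)
  obtain e q where eq: "eq = (e, q)" by (cases eq)
  then obtain p where q: "q \<in> words (S - {t})" and P: "P = p @ [(t, e)] @ q"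
    using fold_scan_Some assms(1) Some by blast
  have invP: "inv_word P = inv_word q @ [(t, \<not> e)] @ inv_word p"
    by (simp add: P letter_inv_def)
  \<comment> \<open>Only the first stable letter of \<open>inv_word P\<close> sees \<open>z\<close>;
    everything after it is scanned from a state independent of \<open>z\<close>.\<close>
  have "pinch_free (Some (e, q @ z)) (inv_word P) \<longleftrightarrow>
      cl (q @ z @ inv_word q) \<notin> A (\<not> e) \<and> pinch_free (Some (\<not> e, [])) (inv_word p)" for z
    using q by (simp add: invP pinch_free_append pinch_free_free fold_scan_free pinch_at_def)
  then have "pinch_free (Some (e, q @ wpow y k)) (inv_word P)"
    using pf A_root_conj[OF q assms(2,3)] assms(2) Some eq
    by (auto simp: pinch_free_append fold_scan_free)
  then show ?thesis
    using pf assms(2) Some eq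
    by (simp add: pinch_free_append fold_scan_free words_wpow pinch_free_free)
qed

text \<open>Every copy of \<open>y\<close> leaves the scan in the same state, so each later copy,
  and finally \<open>inv_word P\<close>, is read as in a situation known to be free of
  pinches.\<close>

lemma pinch_free_conj_wpow_hyperbolic:
  assumes z: "\<And>z'. fold scan y z' = z" "pinch_free z y" and "k \<ge> 1"
    and pf: "pinch_free None (P @ y @ inv_word P)"
  shows "pinch_free None (P @ wpow y k @ inv_word P)"
proof -
  have "pinch_free z (wpow y j) \<and> fold scan (wpow y j) z = z" for j
    by (induction j) (auto simp: pinch_free_append z)
  moreover obtain j where "k = Suc j"
    using assms(3) by (cases k) auto
  ultimately show ?thesis
    using pf z by (auto simp: pinch_free_append)
qed

text \<open>If a pinch spans the seam of two copies of \<open>y\<close>, sliding turns the end of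
  \<open>y\<close> into \<open>f\<close> followed by the inverse of its beginning
  \<open>q @ [(t, e)]\<close>. So \<open>y\<close> is a conjugate of \<open>u @ f\<close>, which has
  two stable letters fewer.\<close>

lemma cyclic_pinch_shift:
  assumes yS: "y \<in> words S" and pf: "pinch_free z' y"
    and y2: "y = y2 @ [(t, em)] @ qm" "qm \<in> words (S - {t})"
    and npf: "\<not> pinch_free (Some (em, qm)) y"
  obtains q e u f where "y = q @ [(t, e)] @ u @ [(t, \<not> e)] @ qm" "q \<in> words (S - {t})"
    "f \<in> words (S - {t})" "([(t, \<not> e)] @ qm, f @ [(t, \<not> e)] @ inv_word q) \<in> pres_rel S R"
proof -
  have "tcount y > 0" by (simp add: y2)
  then obtain q e y1 where y1: "y = q @ [(t, e)] @ y1" and q: "q \<in> words (S - {t})"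
    using split_first_stable yS by blast
  \<comment> \<open>Scans of \<open>y\<close> from different states agree once its first stable
    letter has been read, so the pinch must occur at that letter.\<close>
  have "pinch_at (Some (em, qm @ q)) (t, e)"
    using pf npf q by (simp add: y1 pinch_free_append pinch_free_free fold_scan_free)
  then have e: "em = (\<not> e)" and qA: "cl (qm @ q) \<in> A e"
    by (auto simp: pinch_at_def)
  \<comment> \<open>The first and last stable letters have opposite signs, so they are distinct
    occurrences and enclose some \<open>u\<close>.\<close>
  have "(t, em) \<notin> set q"
    using q by (auto simp: words_def lists_eq_set)
  moreover have "q @ (t, e) # y1 = y2 @ (t, em) # qm"
    using y1 y2 by simp
  ultimately obtain u where "y1 = u @ (t, em) # qm"
    using e by (auto simp: append_eq_append_conv2 append_eq_Cons_conv Cons_eq_append_conv)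
  then have y: "y = q @ [(t, e)] @ u @ [(t, \<not> e)] @ qm"
    using y1 e by simp
  have "cl (rev (qm @ q)) \<in> A (\<not> e)"
    using phi_closed[OF qA] rev_cl[of "qm @ q"] y2(2) q by simp
  then have "(rev (qm @ q) @ [(t, \<not> e)], [(t, \<not> e)] @ rev (rev (qm @ q))) \<in> pres_rel S R"
    using y2(2) q by (intro slide) auto
  then have "(([(t, \<not> e)] @ qm) @ q, rev (qm @ q) @ [(t, \<not> e)]) \<in> pres_rel S R"
    by (auto intro: pres_rel.sym)
  then have "([(t, \<not> e)] @ qm, rev (qm @ q) @ [(t, \<not> e)] @ inv_word q) \<in> pres_rel S R"
    using pres_rel_cancel_right by fastforce
  then show ?thesis
    using that[OF y q, of "rev (qm @ q)"] y2(2) q by simp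
qed

text \<open>
  Write \<open>w\<close> as \<open>P y P\<^sup>-\<^sup>1\<close> with as few stable letters as possible and, subject to that, as few as
  possible in \<open>y\<close>. Then no pinch occurs between consecutive copies of \<open>y\<close>.
\<close>

lemma tlength_wpow:
  assumes w: "w \<in> words S"
  shows "\<exists>D \<tau>. \<forall>k\<ge>1. tlength (wpow w k) = D + k * \<tau>"
proof -
  \<comment> \<open>The count condition makes the factorisation attain the HNN length of
    \<open>w\<close>, and hence free of pinches.\<close>
  define Q where "Q = (\<lambda>(P, y). (w, P @ y @ inv_word P) \<in> pres_rel S R \<and>
    2 * tcount P + tcount y = tlength w)"
  obtain v where "Q ([], v)"
    using ex_tcount_eq_tlength[OF w] by (auto simp: Q_def)
  then obtain Py where "Q Py" and "\<And>Py'. Q Py' \<Longrightarrow> tcount (snd Py) \<le> tcount (snd Py')"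
    using ex_has_least_nat[of Q _ "\<lambda>Py. tcount (snd Py)"] by metis
  then obtain P y where Q: "Q (P, y)" and min: "\<And>P' y'. Q (P', y') \<Longrightarrow> tcount y \<le> tcount y'"
    by (metis prod.collapse snd_conv)
  from Q have rel: "(w, P @ y @ inv_word P) \<in> pres_rel S R"
    and count: "2 * tcount P + tcount y = tlength w"
    by (auto simp: Q_def)
  then have PyS: "P \<in> words S" "y \<in> words S"
    using pres_rel_words[OF rel] by auto
  have pf: "pinch_free None (P @ y @ inv_word P)"
    using PyS count tlength_pres_rel[OF rel] by (simp add: pinch_free_iff)
  have "pinch_free None (P @ wpow y k @ inv_word P)" if k: "k \<ge> 1" for k
  proof (cases "fold scan y None")
    case None
    then show ?thesis
      using pinch_free_conj_wpow_elliptic fold_scan_None PyS k pf by blast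
  next
    case (Some z)
    obtain em qm where z: "z = (em, qm)" by (cases z)
    then obtain y2 where y2: "y = y2 @ [(t, em)] @ qm" and qm: "qm \<in> words (S - {t})"
      using fold_scan_Some PyS(2) Some by blast
    have scan_y: "fold scan y z' = Some (em, qm)" for z'
      using qm by (simp add: y2 fold_scan_free)
    have "pinch_free (Some (em, qm)) y"
    proof (rule ccontr)
      assume "\<not> pinch_free (Some (em, qm)) y"
      moreover have "pinch_free (fold scan P None) y"
        using pf by (simp add: pinch_free_append)
      ultimately obtain q e u f where y: "y = q @ [(t, e)] @ u @ [(t, \<not> e)] @ qm"
          and q: "q \<in> words (S - {t})" and f: "f \<in> words (S - {t})"
          and slide: "([(t, \<not> e)] @ qm, f @ [(t, \<not> e)] @ inv_word q) \<in> pres_rel S R"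
        using cyclic_pinch_shift[OF PyS(2) _ y2 qm] by metis
      \<comment> \<open>The first stable letter of \<open>y\<close> moves into \<open>P\<close> and
        the last into its inverse: the total count is unchanged while that of \<open>y\<close> drops
        by two.\<close>
      define P' y' where "P' = P @ q @ [(t, e)]" and "y' = u @ f"
      have "(P @ y @ inv_word P, P' @ y' @ inv_word P') \<in> pres_rel S R"
        using pres_rel_context[OF slide, of "P @ q @ [(t, e)] @ u" "inv_word P"] PyS
        by (simp add: y P'_def y'_def letter_inv_def)
      then have "(w, P' @ y' @ inv_word P') \<in> pres_rel S R"
        using rel pres_rel.trans by blast
      moreover have "tcount q = 0" "tcount f = 0" "tcount qm = 0"
        using q f qm tcount_eq_0 words_mono by blast+
      then have "2 * tcount P' + tcount y' = 2 * tcount P + tcount y" "tcount y' < tcount y"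
        by (simp_all add: y P'_def y'_def)
      ultimately show False
        using min[of P' y'] count by (simp add: Q_def)
    qed
    then show ?thesis
      using pinch_free_conj_wpow_hyperbolic scan_y k pf by blast
  qed
  then have "tlength (P @ wpow y k @ inv_word P) = 2 * tcount P + k * tcount y" if "k \<ge> 1" for k
    using that PyS pinch_free_tlength[of "P @ wpow y k @ inv_word P"] by (simp add: words_wpow)
  moreover have "(wpow w k, P @ wpow y k @ inv_word P) \<in> pres_rel S R" if "k \<ge> 1" for k
    using pres_rel_wpow[OF rel] pres_rel_conj_wpow[OF PyS that] pres_rel.trans by blast
  ultimately have "\<forall>k\<ge>1. tlength (wpow w k) = 2 * tcount P + k * tcount y"
    using tlength_pres_rel by metis
  then show ?thesis by blast
qed

end

section \<open>The surface group\<close>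

text \<open>The coefficients may depend on \<open>i\<close> but not on the choice of the shortest
  representative \<open>v\<close>.\<close>

lemma surface_letter_count:
  assumes i: "i \<in> {1..2 * g}" and w: "w \<in> words {1..2 * g}"
  shows "\<exists>D \<tau>. \<forall>k\<ge>1. \<forall>v. (wpow w k, v) \<in> pres_rel {1..2 * g} {surface_relator g} \<longrightarrow>
    (\<forall>u. (v, u) \<in> pres_rel {1..2 * g} {surface_relator g} \<longrightarrow> length v \<le> length u) \<longrightarrow>
    count_list (map fst v) i = D + k * \<tau>"
proof -
  let ?T = "map (\<lambda>j. (j, True))" and ?F = "map (\<lambda>j. (j, False))"
  let ?p = "[1..<i]" and ?q = "[i + 1..<2 * g + 1]"
  have map_words: "map (\<lambda>j. (j, b)) xs \<in> words X \<longleftrightarrow> set xs \<subseteq> X" for b xs and X :: "nat set"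
    by (induction xs) auto
  have map_inv: "inv_word (map (\<lambda>j. (j, b)) xs) = rev (map (\<lambda>j. (j, \<not> b)) xs)" for b and xs :: "nat list"
    by (induction xs) (auto simp: letter_inv_def)
  \<comment> \<open>The relator is cut at the two occurrences of the generator \<open>i\<close>:
    \<alpha> precedes the first, \<open>a\<close> lies between them and \<gamma> follows the
    second.\<close>
  interpret stable_letter "{1..2 * g}" i "?T ?q @ ?F ?p" "?T ?p" "?F ?q"
  proof
    show "rev (?T ?q @ ?F ?p) = inv_word (?F ?q @ ?T ?p)"
      by (simp add: map_inv)
    show "distinct (map fst (?T ?q @ ?F ?p))"
      by (auto simp: comp_def)
  qed (use i in \<open>auto simp: map_words\<close>)
  have "[1..<2 * g + 1] = ?p @ i # ?q"
    using i upt_add_eq_append[of 1 i "2 * g + 1 - i"] by (simp add: upt_conv_Cons)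
  then have "{surface_relator g} = R"
    by (simp add: surface_relator_def)
  moreover obtain D \<tau> where "\<And>k. k \<ge> 1 \<Longrightarrow> tlength (wpow w k) = D + k * \<tau>"
    using tlength_wpow[OF w] by blast
  moreover have "tcount v = tlength w'" if "(w', v) \<in> pres_rel {1..2 * g} R"
      "\<And>u. (v, u) \<in> pres_rel {1..2 * g} R \<Longrightarrow> length v \<le> length u" for w' v
    using shortest_tcount[of v] that pres_rel_words[OF that(1)] tlength_pres_rel[OF that(1)] by simp
  ultimately have "\<forall>k\<ge>1. \<forall>v. (wpow w k, v) \<in> pres_rel {1..2 * g} {surface_relator g} \<longrightarrow>
      (\<forall>u. (v, u) \<in> pres_rel {1..2 * g} {surface_relator g} \<longrightarrow> length v \<le> length u) \<longrightarrow>
      tcount v = D + k * \<tau>"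
    by simp
  then show ?thesis
    unfolding tcount_def by blast
qed

text \<open>Lists of generators and inverses in the group correspond to words of the same length, so
  word length is attained by a shortest word in the class.\<close>

lemma presented_word_length:
  assumes "w \<in> words S"
  obtains v where "(w, v) \<in> pres_rel S R"
    "word_length (presented_group S R) (pres_gen S R ` S) (pres_rel S R `` {w}) = length v"
    "\<And>u. (v, u) \<in> pres_rel S R \<Longrightarrow> length v \<le> length u"
proof -
  let ?G = "presented_group S R" and ?c = "\<lambda>w. pres_rel S R `` {w}"
  let ?L = "pres_gen S R ` S \<union> m_inv ?G ` pres_gen S R ` S"
  obtain v where v: "(w, v) \<in> pres_rel S R" "\<And>u. (w, u) \<in> pres_rel S R \<Longrightarrow> length v \<le> length u"
    using ex_has_least_nat[of "\<lambda>v. (w, v) \<in> pres_rel S R" w length] assms pres_rel.refl by metis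
  have letter: "\<exists>x. [x] \<in> words S \<and> X = ?c [x]" if "X \<in> ?L" for X
    using that presented_inv_gen[of _ S R] by (force simp: pres_gen_def)
  have upper: "\<exists>xs. length xs = length u \<and> set xs \<subseteq> ?L \<and> ?c u = foldr (\<lambda>a b. a \<otimes>\<^bsub>?G\<^esub> b) xs \<one>\<^bsub>?G\<^esub>"
    if "u \<in> words S" for u
    using that
  proof (induction u)
    case (Cons x u)
    then obtain xs where xs: "length xs = length u" "set xs \<subseteq> ?L"
        "?c u = foldr (\<lambda>a b. a \<otimes>\<^bsub>?G\<^esub> b) xs \<one>\<^bsub>?G\<^esub>"
      by auto
    obtain s b where x: "x = (s, b)" by (cases x)
    have "?c [x] \<in> ?L"
      using Cons.prems x presented_inv_gen[of s S R]
      by (cases b) (auto simp: pres_gen_def image_iff intro!: bexI[of _ s])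
    moreover have "?c (x # u) = ?c [x] \<otimes>\<^bsub>?G\<^esub> ?c u"
      using Cons.prems by (simp add: presented_mult)
    ultimately show ?case
      using xs by (intro exI[of _ "?c [x] # xs"]) simp
  qed (simp add: presented_one)
  have lower: "\<exists>u\<in>words S. length u = length xs \<and> foldr (\<lambda>a b. a \<otimes>\<^bsub>?G\<^esub> b) xs \<one>\<^bsub>?G\<^esub> = ?c u"
    if "set xs \<subseteq> ?L" for xs
    using that
  proof (induction xs)
    case (Cons X xs)
    then obtain u where "u \<in> words S" "length u = length xs"
        "foldr (\<lambda>a b. a \<otimes>\<^bsub>?G\<^esub> b) xs \<one>\<^bsub>?G\<^esub> = ?c u"
      by auto
    moreover obtain x where "[x] \<in> words S" "X = ?c [x]"
      using letter[of X] Cons.prems by force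
    ultimately show ?case
      using presented_mult[of "[x]" S u R] by (intro bexI[of _ "x # u"]) simp_all
  qed (simp add: presented_one)
  have "word_length ?G (pres_gen S R ` S) (?c w) = length v"
    unfolding word_length_def
  proof (rule Least_equality)
    have "?c w = ?c v"
      using v(1) by (rule equiv_class_eq[OF equiv_pres_rel])
    then show "\<exists>xs. length xs = length v \<and> set xs \<subseteq> ?L \<and> ?c w = foldr (\<lambda>a b. a \<otimes>\<^bsub>?G\<^esub> b) xs \<one>\<^bsub>?G\<^esub>"
      using upper[of v] pres_rel_words[OF v(1)] by simp
  next
    fix n assume "\<exists>xs. length xs = n \<and> set xs \<subseteq> ?L \<and> ?c w = foldr (\<lambda>a b. a \<otimes>\<^bsub>?G\<^esub> b) xs \<one>\<^bsub>?G\<^esub>"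
    then obtain u where u: "u \<in> words S" "length u = n" "?c w = ?c u"
      using lower by metis
    then have "(w, u) \<in> pres_rel S R"
      using eq_equiv_class_iff[OF equiv_pres_rel assms u(1)] by blast
    then show "length v \<le> n"
      using v(2) u(2) by blast
  qed
  moreover have "length v \<le> length u" if "(v, u) \<in> pres_rel S R" for u
    using v that pres_rel.trans by blast
  ultimately show ?thesis
    using that v(1) by blast
qed

text \<open>The length of a shortest word is the sum of its letter counts, and each of these is
  affine in \<open>k\<close>.\<close>

lemma surface_length_pow:
  assumes w: "w \<in> words {1..2 * g}"
    and x: "x = pres_rel {1..2 * g} {surface_relator g} `` {w}"
  shows "\<exists>D \<tau>. \<forall>k\<ge>1. surface_length g (x [^]\<^bsub>surface_group g\<^esub> (k :: nat)) = D + k * \<tau>"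
proof -
  let ?S = "{1..2 * g}" and ?R = "{surface_relator g}"
  obtain D \<tau> where count: "\<And>i k v. i \<in> ?S \<Longrightarrow> k \<ge> 1 \<Longrightarrow> (wpow w k, v) \<in> pres_rel ?S ?R \<Longrightarrow>
      (\<And>u. (v, u) \<in> pres_rel ?S ?R \<Longrightarrow> length v \<le> length u) \<Longrightarrow>
      count_list (map fst v) i = D i + k * \<tau> i"
    using surface_letter_count[OF _ w] by metis
  have "surface_length g (x [^]\<^bsub>surface_group g\<^esub> k) = sum D ?S + k * sum \<tau> ?S"
    if k: "k \<ge> 1" for k :: nat
  proof -
    obtain v where v: "(wpow w k, v) \<in> pres_rel ?S ?R"
        "word_length (presented_group ?S ?R) (pres_gen ?S ?R ` ?S) (pres_rel ?S ?R `` {wpow w k}) = length v"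
        "\<And>u. (v, u) \<in> pres_rel ?S ?R \<Longrightarrow> length v \<le> length u"
      using presented_word_length[OF words_wpow[OF w], of k ?R] by blast
    have "set (map fst v) \<subseteq> ?S"
      using pres_rel_words[OF v(1)] by (auto simp: words_def lists_eq_set)
    then have "length v = (\<Sum>i\<in>?S. count_list (map fst v) i)"
      using sum_count_set[of "map fst v" ?S] by simp
    also have "\<dots> = (\<Sum>i\<in>?S. D i + k * \<tau> i)"
      using count[OF _ k v(1) v(3)] by simp
    also have "\<dots> = sum D ?S + k * sum \<tau> ?S"
      by (simp add: sum.distrib sum_distrib_left)
    finally show ?thesis
      unfolding x surface_group_def surface_gens_def presented_nat_pow[OF w] v(2) .
  qed
  then show ?thesis by blast
qed

text \<open>Only finitely many words have length \<open>D\<close>, so two powers coincide and some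
  positive power is trivial. Its length 0 must equal \<open>D\<close>.\<close>

lemma surface_length_bounded_imp_one:
  assumes x: "x \<in> carrier (surface_group g)"
    and bounded: "\<And>k :: nat. k \<ge> 1 \<Longrightarrow> surface_length g (x [^]\<^bsub>surface_group g\<^esub> k) = D"
  shows "x = \<one>\<^bsub>surface_group g\<^esub>"
proof -
  let ?S = "{1..2 * g}" and ?R = "{surface_relator g}" and ?G = "surface_group g"
  let ?c = "\<lambda>w. pres_rel ?S ?R `` {w}"
  interpret group ?G by (rule group_surface_group)
  have shortest: "\<exists>v\<in>words ?S. y = ?c v \<and> length v = surface_length g y"
    if "y \<in> carrier ?G" for y
  proof -
    obtain w where w: "w \<in> words ?S" "y = ?c w"
      using \<open>y \<in> carrier ?G\<close> by (auto simp only: surface_group_def elim: presented_carrierE)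
    obtain v where v: "(w, v) \<in> pres_rel ?S ?R"
        "word_length (presented_group ?S ?R) (pres_gen ?S ?R ` ?S) (?c w) = length v"
      using presented_word_length[OF w(1), of ?R] by blast
    then show ?thesis
      using w equiv_class_eq[OF equiv_pres_rel v(1)] pres_rel_words[OF v(1)]
      by (auto simp: surface_group_def surface_gens_def)
  qed
  have "finite {v. set v \<subseteq> ?S \<times> (UNIV :: bool set) \<and> length v = D}"
    by (intro finite_lists_length_eq finite_cartesian_product) simp_all
  moreover have "(\<lambda>k :: nat. x [^]\<^bsub>?G\<^esub> k) ` {1..} \<subseteq> ?c ` {v. set v \<subseteq> ?S \<times> UNIV \<and> length v = D}"
  proof
    fix y assume "y \<in> (\<lambda>k :: nat. x [^]\<^bsub>?G\<^esub> k) ` {1..}"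
    then obtain k :: nat where k: "k \<ge> 1" "y = x [^]\<^bsub>?G\<^esub> k" by auto
    then obtain v where "v \<in> words ?S" "y = ?c v" "length v = D"
      using shortest[of y] nat_pow_closed[OF x] bounded[OF k(1)] by metis
    then show "y \<in> ?c ` {v. set v \<subseteq> ?S \<times> UNIV \<and> length v = D}"
      by (intro image_eqI[of _ _ v]) (simp_all add: words_def lists_eq_set)
  qed
  ultimately have "finite ((\<lambda>k :: nat. x [^]\<^bsub>?G\<^esub> k) ` {1..})"
    by (meson finite_imageI finite_subset)
  then have "\<not> inj_on (\<lambda>k :: nat. x [^]\<^bsub>?G\<^esub> k) {1..}"
    using finite_imageD[of "\<lambda>k :: nat. x [^]\<^bsub>?G\<^esub> k" "{1..}"] infinite_Ici by auto
  then obtain j k :: nat where jk: "j < k" "x [^]\<^bsub>?G\<^esub> j = x [^]\<^bsub>?G\<^esub> k"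
    unfolding inj_on_def by (metis linorder_neqE_nat)
  have "x [^]\<^bsub>?G\<^esub> j \<otimes>\<^bsub>?G\<^esub> x [^]\<^bsub>?G\<^esub> (k - j) = x [^]\<^bsub>?G\<^esub> j"
    using jk(1) x nat_pow_mult[OF x, of j "k - j"] by (simp add: jk(2))
  then have "x [^]\<^bsub>?G\<^esub> (k - j) = \<one>\<^bsub>?G\<^esub>"
    using x by (simp add: l_cancel_one)
  moreover have "surface_length g \<one>\<^bsub>?G\<^esub> = 0"
    unfolding word_length_def by (rule Least_eq_0) (auto intro: exI[of _ "[]"])
  ultimately have "D = 0"
    using bounded[of "k - j"] jk(1) by simp
  then have "surface_length g x = 0"
    using bounded[of 1] x by simp
  then show ?thesis
    using shortest[OF x] by (auto simp: surface_group_def presented_one)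
qed

theorem theorem1p1:
  fixes g :: nat and x :: "nat word set"
  assumes "g \<ge> 2"
    and "x \<in> carrier (surface_group g)"
    and "x \<noteq> \<one>\<^bsub>surface_group g\<^esub>"
  shows "surface_length g (x [^]\<^bsub>surface_group g\<^esub> (2::nat)) > surface_length g x \<and>
    (\<forall>k::nat. k \<ge> 1 \<longrightarrow>
      int (surface_length g (x [^]\<^bsub>surface_group g\<^esub> k)) =
        (int k - 1) *
          (int (surface_length g (x [^]\<^bsub>surface_group g\<^esub> (2::nat))) - int (surface_length g x))
        + int (surface_length g x)) \<and>
    surface_tau g x =
      real (surface_length g (x [^]\<^bsub>surface_group g\<^esub> (2::nat))) - real (surface_length g x)"
proof -
  let ?len = "\<lambda>k :: nat. surface_length g (x [^]\<^bsub>surface_group g\<^esub> k)"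
  interpret group "surface_group g" by (rule group_surface_group)
  obtain w where "w \<in> words {1..2 * g}" "x = pres_rel {1..2 * g} {surface_relator g} `` {w}"
    using assms(2) by (auto simp only: surface_group_def elim: presented_carrierE)
  then obtain D \<tau> where len: "\<And>k. k \<ge> 1 \<Longrightarrow> ?len k = D + k * \<tau>"
    using surface_length_pow by blast
  have len1: "surface_length g x = D + \<tau>"
    using len[of 1] assms(2) by simp
  \<comment> \<open>For slope 0 all positive powers would have the same length
    \<open>D\<close>.\<close>
  have "\<tau> \<noteq> 0"
    using surface_length_bounded_imp_one[OF assms(2), of D] len assms(3) by auto
  moreover have "surface_tau g x = real \<tau>"
    unfolding stable_length_def
  proof (rule limI)
    have "(\<lambda>n. real D / real n + real \<tau>) \<longlonglongrightarrow> 0 + real \<tau>"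
      by (intro tendsto_add lim_const_over_n tendsto_const)
    moreover have "\<forall>\<^sub>F n in sequentially. real D / real n + real \<tau> = real (?len n) / real n"
      \<comment> \<open>The affine formula is available from exponent 1 on, so index 0 is left
        out.\<close>
      using eventually_ge_at_top[of 1] by eventually_elim (simp add: len field_simps)
    ultimately show "(\<lambda>n. real (?len n) / real n) \<longlonglongrightarrow> real \<tau>"
      using Lim_transform_eventually by fastforce
  qed
  \<comment> \<open>The slope is the difference of the lengths at exponents 2 and 1; all three
    claims are read off from the affine formula.\<close>
  ultimately show ?thesis
    using len[of 2] len1 by (auto simp: len algebra_simps)
qed

end
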